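(* If $\mathcal G$ is an étale groupoid, then $\mathcal A_r(\mathcal G)=C^*_{red}(\mathcal G)$.
   Context: An étale groupoid $\mathcal G$ is a topological groupoid whose unit space $\mathcal G^{(0)}$ is locally compact Hausdorff and whose source and range maps $\mathbf d,\mathbf r$ are local homeomorphisms; $\mathcal G$ need not be Hausdorff. For $u\in\mathcal G^{(0)}$, $\mathcal G_u=\{x\in\mathcal G:\mathbf d(x)=u\}$. For an open Hausdorff $V\subseteq\mathcal G$, $C_c(V)$ denotes the functions $f:\mathcal G\to\mathbb C$ vanishing off $V$ whose restriction to $V$ is continuous with compact support. $\mathcal A_0(\mathcal G)$ is the linear span of all $C_c(V)$, $V$ open Hausdorff, an algebra under $(f*g)(z)=\sum_{xy=z}f(x)g(y)$ with involution $f^*(x)=\overline{f(x^{-1})}$. $\mathcal A_r(\mathcal G)$, the reduced operator algebra of $\mathcal G$ viewed as a (left cancellative) étale category, is the norm closure of the image of $\mathcal A_0(\mathcal G)$ under the regular representation $\pi:\mathcal A_0(\mathcal G)\to B(\ell_2(\mathcal G))$, where $\pi(f)\delta_z=\sum_{x\in\mathcal G_{\mathbf r(z)}}f(x)\delta_{xz}$ and $\{\delta_z\}_{z\in\mathcal G}$ is the canonical orthonormal basis of $\ell_2(\mathcal G)$. $C^*_{red}(\mathcal G)$ is the reduced groupoid $C^*$-algebra: the completion of $\mathcal A_0(\mathcal G)$ in the norm $\|f\|_{red}=\sup_{u\in\mathcal G^{(0)}}\|\pi_u(f)\|$, where $\pi_u:\mathcal A_0(\mathcal G)\to B(\ell_2(\mathcal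 G_u))$ is $\pi_u(f)\delta_z=\sum_{x\in\mathcal G_{\mathbf r(z)}}f(x)\delta_{xz}$ for $z\in\mathcal G_u$. The equality is as completions of $\mathcal A_0(\mathcal G)$, i.e. the two norms on $\mathcal A_0(\mathcal G)$ agree. *)

theory Defs
  imports "HOL-Analysis.Analysis"
begin

section \<open>Etale groupoids\<close>

text \<open>The set of arrows is the topspace of the topology \<open>gtop\<close>; units are identified with identity
  arrows. A product \<open>xy\<close> is meaningful iff \<open>src x = rng y\<close>.\<close>

record 'a topological_groupoid =
  gtop :: "'a topology"
  src :: "'a \<Rightarrow> 'a"
  rng :: "'a \<Rightarrow> 'a"
  gmult :: "'a \<Rightarrow> 'a \<Rightarrow> 'a"
  ginv :: "'a \<Rightarrow> 'a"

abbreviation arrows :: "'a topological_groupoid \<Rightarrow> 'a set" where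
  "arrows G \<equiv> topspace (gtop G)"

definition units :: "'a topological_groupoid \<Rightarrow> 'a set" where
  "units G = src G ` arrows G"

definition fibre :: "'a topological_groupoid \<Rightarrow> 'a \<Rightarrow> 'a set" where
  "fibre G u = {x \<in> arrows G. src G x = u}"

definition composable :: "'a topological_groupoid \<Rightarrow> ('a \<times> 'a) set" where
  "composable G = {(x, y). x \<in> arrows G \<and> y \<in> arrows G \<and> src G x = rng G y}"

definition groupoid :: "'a topological_groupoid \<Rightarrow> bool" where
  "groupoid G \<longleftrightarrow>
     (\<forall>x \<in> arrows G.
        src G x \<in> arrows G \<and> rng G x \<in> arrows G \<and> ginv G x \<in> arrows G \<and>
        src G (src G x) = src G x \<and> rng G (src G x) = src G x \<and>
        src G (rng G x) = rng G x \<and> rng G (rng G x) = rng G x \<and>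
        gmult G x (src G x) = x \<and> gmult G (rng G x) x = x \<and>
        src G (ginv G x) = rng G x \<and> rng G (ginv G x) = src G x \<and>
        gmult G (ginv G x) x = src G x \<and> gmult G x (ginv G x) = rng G x) \<and>
     (\<forall>(x, y) \<in> composable G.
        gmult G x y \<in> arrows G \<and>
        src G (gmult G x y) = src G y \<and> rng G (gmult G x y) = rng G x) \<and>
     (\<forall>x y z. (x, y) \<in> composable G \<longrightarrow> (y, z) \<in> composable G \<longrightarrow>
        gmult G (gmult G x y) z = gmult G x (gmult G y z))"

definition is_topological_groupoid :: "'a topological_groupoid \<Rightarrow> bool" where
  "is_topological_groupoid G \<longleftrightarrow>
     groupoid G \<and>
     continuous_map (subtopology (prod_topology (gtop G) (gtop G)) (composable G)) (gtop G)
       (\<lambda>(x, y). gmult G x y) \<and>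
     continuous_map (gtop G) (gtop G) (ginv G)"

definition local_homeomorphism :: "'a topology \<Rightarrow> 'b topology \<Rightarrow> ('a \<Rightarrow> 'b) \<Rightarrow> bool" where
  "local_homeomorphism X Y f \<longleftrightarrow>
     (\<forall>x \<in> topspace X. \<exists>U. openin X U \<and> x \<in> U \<and> openin Y (f ` U) \<and>
        homeomorphic_map (subtopology X U) (subtopology Y (f ` U)) f)"

abbreviation unit_space :: "'a topological_groupoid \<Rightarrow> 'a topology" where
  "unit_space G \<equiv> subtopology (gtop G) (units G)"

definition etale_groupoid :: "'a topological_groupoid \<Rightarrow> bool" where
  "etale_groupoid G \<longleftrightarrow>
     is_topological_groupoid G \<and>
     locally_compact_space (unit_space G) \<and> Hausdorff_space (unit_space G) \<and>
     local_homeomorphism (gtop G) (unit_space G) (src G) \<and>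
     local_homeomorphism (gtop G) (unit_space G) (rng G)"


section \<open>Normed *-algebras and their completions\<close>

record 'b normed_star_algebra =
  carr :: "'b set"
  aadd :: "'b \<Rightarrow> 'b \<Rightarrow> 'b"
  ascale :: "complex \<Rightarrow> 'b \<Rightarrow> 'b"
  amult :: "'b \<Rightarrow> 'b \<Rightarrow> 'b"
  astar :: "'b \<Rightarrow> 'b"
  nrm :: "'b \<Rightarrow> real"

definition dist_in :: "'b normed_star_algebra \<Rightarrow> 'b \<Rightarrow> 'b \<Rightarrow> real" where
  "dist_in A a b = nrm A (aadd A a (ascale A (-1) b))"

text \<open>Completion by Cauchy sequences modulo sequences of distance tending to zero.\<close>

definition Cauchy_seqs :: "'b normed_star_algebra \<Rightarrow> (nat \<Rightarrow> 'b) set" where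
  "Cauchy_seqs A = {s. (\<forall>n. s n \<in> carr A) \<and>
     (\<forall>e>0. \<exists>N. \<forall>m\<ge>N. \<forall>n\<ge>N. dist_in A (s m) (s n) < e)}"

definition Cauchy_rel :: "'b normed_star_algebra \<Rightarrow> ((nat \<Rightarrow> 'b) \<times> (nat \<Rightarrow> 'b)) set" where
  "Cauchy_rel A = {(s, t). s \<in> Cauchy_seqs A \<and> t \<in> Cauchy_seqs A \<and>
     (\<lambda>n. dist_in A (s n) (t n)) \<longlonglongrightarrow> 0}"

definition completion :: "'b normed_star_algebra \<Rightarrow> (nat \<Rightarrow> 'b) set normed_star_algebra" where
  "completion A = \<lparr>
     carr = Cauchy_seqs A // Cauchy_rel A,
     aadd = (\<lambda>X Y. \<Union>s\<in>X. \<Union>t\<in>Y. Cauchy_rel A `` {\<lambda>n. aadd A (s n) (t n)}),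
     ascale = (\<lambda>c X. \<Union>s\<in>X. Cauchy_rel A `` {\<lambda>n. ascale A c (s n)}),
     amult = (\<lambda>X Y. \<Union>s\<in>X. \<Union>t\<in>Y. Cauchy_rel A `` {\<lambda>n. amult A (s n) (t n)}),
     astar = (\<lambda>X. \<Union>s\<in>X. Cauchy_rel A `` {\<lambda>n. astar A (s n)}),
     nrm = (\<lambda>X. THE c. \<forall>s\<in>X. (\<lambda>n. nrm A (s n)) \<longlonglongrightarrow> c)\<rparr>"

definition completion_embedding :: "'b normed_star_algebra \<Rightarrow> 'b \<Rightarrow> (nat \<Rightarrow> 'b) set" where
  "completion_embedding A a = Cauchy_rel A `` {\<lambda>n. a}"

text \<open>The membership conditions make sure that \<open>carr A\<close> (hence also \<open>carr B\<close>) is closed under the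
  operations, so that the equations are not about values of \<open>\<Phi>\<close> outside \<open>carr A\<close>.\<close>

definition isometric_star_isomorphism ::
  "'b normed_star_algebra \<Rightarrow> 'c normed_star_algebra \<Rightarrow> ('b \<Rightarrow> 'c) \<Rightarrow> bool" where
  "isometric_star_isomorphism A B \<Phi> \<longleftrightarrow>
     bij_betw \<Phi> (carr A) (carr B) \<and>
     (\<forall>a \<in> carr A. \<forall>b \<in> carr A.
        aadd A a b \<in> carr A \<and> \<Phi> (aadd A a b) = aadd B (\<Phi> a) (\<Phi> b) \<and>
        amult A a b \<in> carr A \<and> \<Phi> (amult A a b) = amult B (\<Phi> a) (\<Phi> b)) \<and>
     (\<forall>c. \<forall>a \<in> carr A. ascale A c a \<in> carr A \<and> \<Phi> (ascale A c a) = ascale B c (\<Phi> a)) \<and>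
     (\<forall>a \<in> carr A. astar A a \<in> carr A \<and> \<Phi> (astar A a) = astar B (\<Phi> a)) \<and>
     (\<forall>a \<in> carr A. nrm B (\<Phi> a) = nrm A a)"


section \<open>Bounded operators on \<open>\<ell>\<^sub>2\<close> of a set\<close>

text \<open>Functions on a set \<open>X\<close> are represented by functions on the whole type vanishing off \<open>X\<close>,
  operators by functions that are \<^term>\<open>undefined\<close> off \<open>\<ell>\<^sub>2(X)\<close>.\<close>

definition ell2 :: "'a set \<Rightarrow> ('a \<Rightarrow> complex) set" where
  "ell2 X = {\<xi>. (\<forall>x. x \<notin> X \<longrightarrow> \<xi> x = 0) \<and> (\<lambda>x. (cmod (\<xi> x))\<^sup>2) summable_on X}"

definition ell2_inner :: "'a set \<Rightarrow> ('a \<Rightarrow> complex) \<Rightarrow> ('a \<Rightarrow> complex) \<Rightarrow> complex" where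
  "ell2_inner X \<xi> \<eta> = (\<Sum>\<^sub>\<infinity>x\<in>X. \<xi> x * cnj (\<eta> x))"

definition ell2_norm :: "'a set \<Rightarrow> ('a \<Rightarrow> complex) \<Rightarrow> real" where
  "ell2_norm X \<xi> = sqrt (\<Sum>\<^sub>\<infinity>x\<in>X. (cmod (\<xi> x))\<^sup>2)"

definition delta :: "'a \<Rightarrow> 'a \<Rightarrow> complex" where
  "delta z = (\<lambda>x. if x = z then 1 else 0)"

type_synonym 'a ell2_op = "('a \<Rightarrow> complex) \<Rightarrow> ('a \<Rightarrow> complex)"

definition bounded_ops :: "'a set \<Rightarrow> 'a ell2_op set" where
  "bounded_ops X = {T \<in> ell2 X \<rightarrow>\<^sub>E ell2 X.
     (\<forall>\<xi> \<in> ell2 X. \<forall>\<eta> \<in> ell2 X. T (\<lambda>x. \<xi> x + \<eta> x) = (\<lambda>x. T \<xi> x + T \<eta> x)) \<and>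
     (\<forall>c. \<forall>\<xi> \<in> ell2 X. T (\<lambda>x. c * \<xi> x) = (\<lambda>x. c * T \<xi> x)) \<and>
     (\<exists>C. \<forall>\<xi> \<in> ell2 X. ell2_norm X (T \<xi>) \<le> C * ell2_norm X \<xi>)}"

definition op_norm :: "'a set \<Rightarrow> 'a ell2_op \<Rightarrow> real" where
  "op_norm X T = (SUP \<xi> \<in> {\<xi> \<in> ell2 X. ell2_norm X \<xi> \<le> 1}. ell2_norm X (T \<xi>))"

definition adjoint_op :: "'a set \<Rightarrow> 'a ell2_op \<Rightarrow> 'a ell2_op" where
  "adjoint_op X T = (THE S. S \<in> bounded_ops X \<and>
     (\<forall>\<xi> \<in> ell2 X. \<forall>\<eta> \<in> ell2 X. ell2_inner X (T \<xi>) \<eta> = ell2_inner X \<xi> (S \<eta>)))"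

definition op_algebra :: "'a set \<Rightarrow> 'a ell2_op normed_star_algebra" where
  "op_algebra X = \<lparr>
     carr = bounded_ops X,
     aadd = (\<lambda>S T. \<lambda>\<xi>\<in>ell2 X. \<lambda>x. S \<xi> x + T \<xi> x),
     ascale = (\<lambda>c T. \<lambda>\<xi>\<in>ell2 X. \<lambda>x. c * T \<xi> x),
     amult = (\<lambda>S T. compose (ell2 X) S T),
     astar = adjoint_op X,
     nrm = op_norm X\<rparr>"


section \<open>The algebra \<open>\<A>\<^sub>0(G)\<close>\<close>

definition Cc :: "'a topological_groupoid \<Rightarrow> 'a set \<Rightarrow> ('a \<Rightarrow> complex) set" where
  "Cc G V = {f. (\<forall>x. x \<notin> V \<longrightarrow> f x = 0) \<and>
     continuous_map (subtopology (gtop G) V) euclidean f \<and>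
     compactin (subtopology (gtop G) V) (subtopology (gtop G) V closure_of {x \<in> V. f x \<noteq> 0})}"

definition A0 :: "'a topological_groupoid \<Rightarrow> ('a \<Rightarrow> complex) set" where
  "A0 G = {f. \<exists>(n::nat) c g.
     (\<forall>i<n. \<exists>V. openin (gtop G) V \<and> Hausdorff_space (subtopology (gtop G) V) \<and> g i \<in> Cc G V) \<and>
     f = (\<lambda>x. \<Sum>i<n. c i * g i x)}"

text \<open>For \<open>f\<close>, \<open>g\<close> in \<open>\<A>\<^sub>0(G)\<close> only finitely many terms of the following sum are nonzero.\<close>

definition convolution ::
  "'a topological_groupoid \<Rightarrow> ('a \<Rightarrow> complex) \<Rightarrow> ('a \<Rightarrow> complex) \<Rightarrow> ('a \<Rightarrow> complex)" where
  "convolution G f g =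
     (\<lambda>z. \<Sum>\<^sub>\<infinity>(x, y)\<in>{(x, y). (x, y) \<in> composable G \<and> gmult G x y = z}. f x * g y)"

definition involution ::
  "'a topological_groupoid \<Rightarrow> ('a \<Rightarrow> complex) \<Rightarrow> ('a \<Rightarrow> complex)" where
  "involution G f = (\<lambda>x. if x \<in> arrows G then cnj (f (ginv G x)) else 0)"

definition A0_algebra ::
  "'a topological_groupoid \<Rightarrow> (('a \<Rightarrow> complex) \<Rightarrow> real) \<Rightarrow> ('a \<Rightarrow> complex) normed_star_algebra" where
  "A0_algebra G p = \<lparr>
     carr = A0 G,
     aadd = (\<lambda>f g x. f x + g x),
     ascale = (\<lambda>c f x. c * f x),
     amult = convolution G,
     astar = involution G,
     nrm = p\<rparr>"


section \<open>Regular representations and reduced algebras\<close>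

text \<open>\<open>left_rep G X f\<close> is the bounded operator on \<open>\<ell>\<^sub>2(X)\<close> with
  \<open>\<delta>\<^sub>z \<mapsto> \<Sum>x. f x \<delta>\<^sub>x\<^sub>z\<close>, \<open>x\<close> ranging over the arrows with source \<open>rng z\<close>. The sum is evaluated
  pointwise; at each point at most one term is nonzero.\<close>

definition left_rep :: "'a topological_groupoid \<Rightarrow> 'a set \<Rightarrow> ('a \<Rightarrow> complex) \<Rightarrow> 'a ell2_op" where
  "left_rep G X f = (THE T. T \<in> bounded_ops X \<and>
     (\<forall>z \<in> X. T (delta z) = (\<lambda>w. \<Sum>\<^sub>\<infinity>x\<in>fibre G (rng G z). f x * delta (gmult G x z) w)))"

definition regular_rep :: "'a topological_groupoid \<Rightarrow> ('a \<Rightarrow> complex) \<Rightarrow> 'a ell2_op" where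
  "regular_rep G = left_rep G (arrows G)"

definition regular_rep_at :: "'a topological_groupoid \<Rightarrow> 'a \<Rightarrow> ('a \<Rightarrow> complex) \<Rightarrow> 'a ell2_op" where
  "regular_rep_at G u = left_rep G (fibre G u)"

definition reduced_operator_algebra :: "'a topological_groupoid \<Rightarrow> 'a ell2_op normed_star_algebra" where
  "reduced_operator_algebra G = (op_algebra (arrows G))
     \<lparr>carr := {T \<in> bounded_ops (arrows G).
        \<forall>e>0. \<exists>f\<in>A0 G. dist_in (op_algebra (arrows G)) T (regular_rep G f) < e}\<rparr>"

text \<open>Inserting 0 only matters for the empty groupoid, where the real supremum of the empty set
  would be unspecified.\<close>

definition red_norm :: "'a topological_groupoid \<Rightarrow> ('a \<Rightarrow> complex) \<Rightarrow> real" where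
  "red_norm G f = Sup (insert 0 ((\<lambda>u. op_norm (fibre G u) (regular_rep_at G u f)) ` units G))"

definition Cstar_red ::
  "'a topological_groupoid \<Rightarrow> (nat \<Rightarrow> 'a \<Rightarrow> complex) set normed_star_algebra" where
  "Cstar_red G = completion (A0_algebra G (red_norm G))"

definition Cstar_red_embedding ::
  "'a topological_groupoid \<Rightarrow> ('a \<Rightarrow> complex) \<Rightarrow> (nat \<Rightarrow> 'a \<Rightarrow> complex) set" where
  "Cstar_red_embedding G = completion_embedding (A0_algebra G (red_norm G))"

end

theory Submission
  imports Defs
begin

text \<open>
The space \<open>\<ell>\<^sub>2(\<G>)\<close> is the orthogonal sum of the spaces \<open>\<ell>\<^sub>2(\<G>\<^sub>u)\<close>, because every arrow has
exactly one source. Multiplying \<open>z\<close> by an arrow on the left does not change its source, so the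
regular representation is block diagonal for this decomposition, with blocks \<open>\<pi>\<^sub>u\<close>. The norm of a
block diagonal operator is the supremum of the norms of its blocks, and this is the equality of the
two norms (\<open>op_norm_regular_rep\<close>).

The explicit form of the regular representation is left convolution: \<open>\<pi>(f) \<xi> = f * \<xi>\<close>
(\<open>left_rep_eq_convolution\<close>). Boundedness rests on the reduction to open bisections, that is, open
sets on which both the source and the range map are injective. Each arrow has a neighbourhood
basis of open bisections, and a partition of unity on the compact support writes a function in
\<open>C\<^sub>c(V)\<close> as a finite sum of functions in \<open>C\<^sub>c(B)\<close> with \<open>B\<close> an open bisection
(\<open>Cc_decompose_bisections\<close>). Convolution with such a function moves coordinates injectively and
multiplies them by bounded factors. The same reduction shows that \<open>\<A>\<^sub>0(\<G>)\<close> is closed under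
convolution and involution: products and inverses of open bisections are open bisections. Open
bisections are Hausdorff even when \<open>\<G>\<close> is not, since they map injectively and continuously to
the Hausdorff unit space.

It remains to pass from equal norms to the completions. The bounded operators on \<open>\<ell>\<^sub>2\<close> form a
complete normed *-algebra, and for any isometric *-homomorphism into such an algebra the closure
of the image is the completion of the domain, by sending the limit of \<open>\<pi>(f\<^sub>n)\<close> to the class of the
Cauchy sequence \<open>f\<^sub>n\<close> (\<open>closure_isometric_image_iso_completion\<close>). Since bounded operators are
determined by their values on point masses, the homomorphism laws of the regular
representation are verified there, where they reduce to groupoid identities and a change of
variables in a single sum.
\<close>

section \<open>Square-summable functions\<close>

lemma ell2_zero: "(\<lambda>x. 0) \<in> ell2 X"
  by (simp add: ell2_def)

lemma ell2_norm_nonneg: "0 \<le> ell2_norm X \<xi>"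
  by (simp add: ell2_norm_def infsum_nonneg)

lemma ell2_vanishes: "\<xi> \<in> ell2 X \<Longrightarrow> x \<notin> X \<Longrightarrow> \<xi> x = 0"
  by (simp add: ell2_def)

text \<open>Membership in \<open>\<ell>\<^sub>2(X)\<close> and norm bounds are tested on finite sets of coordinates, where
  the triangle and Cauchy-Schwarz inequalities for \<^const>\<open>L2_set\<close> apply.\<close>

lemma ell2_boundI:
  assumes van: "\<And>x. x \<notin> X \<Longrightarrow> \<xi> x = 0"
    and bnd: "\<And>F. finite F \<Longrightarrow> F \<subseteq> X \<Longrightarrow> L2_set (\<lambda>x. cmod (\<xi> x)) F \<le> C"
  shows "\<xi> \<in> ell2 X" "ell2_norm X \<xi> \<le> C"
proof -
  have C: "0 \<le> C" using bnd[of "{}"] by simp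
  have sq: "(\<Sum>x\<in>F. (cmod (\<xi> x))\<^sup>2) \<le> C\<^sup>2" if "finite F" "F \<subseteq> X" for F
    using bnd[OF that] C by (simp add: L2_set_def real_sqrt_le_iff' sum_nonneg)
  have summ: "(\<lambda>x. (cmod (\<xi> x))\<^sup>2) summable_on X"
    by (rule nonneg_bdd_above_summable_on) (use sq in \<open>auto simp: bdd_above_def\<close>)
  then show "\<xi> \<in> ell2 X" using van by (simp add: ell2_def)
  have "(\<Sum>\<^sub>\<infinity>x\<in>X. (cmod (\<xi> x))\<^sup>2) \<le> C\<^sup>2"
    by (rule infsum_le_finite_sums[OF summ sq])
  then show "ell2_norm X \<xi> \<le> C"
    using C by (simp add: ell2_norm_def real_le_lsqrt)
qed

lemma L2_set_le_ell2_norm: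
  assumes "\<xi> \<in> ell2 X" "finite F" "F \<subseteq> X"
  shows "L2_set (\<lambda>x. cmod (\<xi> x)) F \<le> ell2_norm X \<xi>"
  unfolding L2_set_def ell2_norm_def
  by (rule real_sqrt_le_mono, rule finite_sum_le_infsum) (use assms in \<open>auto simp: ell2_def\<close>)

lemma cmod_le_ell2_norm:
  assumes "\<xi> \<in> ell2 X"
  shows "cmod (\<xi> x) \<le> ell2_norm X \<xi>"
proof (cases "x \<in> X")
  case True
  then show ?thesis using L2_set_le_ell2_norm[OF assms, of "{x}"] by simp
next
  case False
  then show ?thesis using assms by (simp add: ell2_vanishes ell2_norm_nonneg)
qed

lemma ell2_norm_zero_iff: "\<xi> \<in> ell2 X \<Longrightarrow> ell2_norm X \<xi> = 0 \<longleftrightarrow> \<xi> = (\<lambda>x. 0)"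
  using cmod_le_ell2_norm[of \<xi> X] by (auto simp: fun_eq_iff ell2_norm_def)

lemma ell2_add:
  assumes "\<xi> \<in> ell2 X" "\<eta> \<in> ell2 X"
  shows "(\<lambda>x. \<xi> x + \<eta> x) \<in> ell2 X"
    and "ell2_norm X (\<lambda>x. \<xi> x + \<eta> x) \<le> ell2_norm X \<xi> + ell2_norm X \<eta>"
proof -
  have "L2_set (\<lambda>x. cmod (\<xi> x + \<eta> x)) F \<le> ell2_norm X \<xi> + ell2_norm X \<eta>"
    if F: "finite F" "F \<subseteq> X" for F
  proof -
    have "L2_set (\<lambda>x. cmod (\<xi> x + \<eta> x)) F \<le> L2_set (\<lambda>x. cmod (\<xi> x) + cmod (\<eta> x)) F"
      by (rule L2_set_mono) (auto intro: norm_triangle_ineq)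
    also have "\<dots> \<le> L2_set (\<lambda>x. cmod (\<xi> x)) F + L2_set (\<lambda>x. cmod (\<eta> x)) F"
      by (rule L2_set_triangle_ineq)
    also have "\<dots> \<le> ell2_norm X \<xi> + ell2_norm X \<eta>"
      using assms F by (intro add_mono L2_set_le_ell2_norm)
    finally show ?thesis .
  qed
  then show "(\<lambda>x. \<xi> x + \<eta> x) \<in> ell2 X"
    "ell2_norm X (\<lambda>x. \<xi> x + \<eta> x) \<le> ell2_norm X \<xi> + ell2_norm X \<eta>"
    using ell2_boundI[of X "\<lambda>x. \<xi> x + \<eta> x" "ell2_norm X \<xi> + ell2_norm X \<eta>"] assms
    by (auto simp: ell2_vanishes)
qed

lemma ell2_norm_scale: "ell2_norm X (\<lambda>x. c * \<xi> x) = cmod c * ell2_norm X \<xi>"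
  by (simp add: ell2_norm_def norm_mult power_mult_distrib infsum_cmult_right' real_sqrt_mult)

lemma ell2_scale: "\<xi> \<in> ell2 X \<Longrightarrow> (\<lambda>x. c * \<xi> x) \<in> ell2 X"
  by (auto simp: ell2_def norm_mult power_mult_distrib intro: summable_on_cmult_right)

lemma ell2_diff:
  assumes "\<xi> \<in> ell2 X" "\<eta> \<in> ell2 X"
  shows "(\<lambda>x. \<xi> x - \<eta> x) \<in> ell2 X"
  using ell2_add(1)[OF assms(1) ell2_scale[OF assms(2), of "-1"]] by simp

lemma ell2_sum:
  "finite F \<Longrightarrow> (\<And>i. i \<in> F \<Longrightarrow> \<xi> i \<in> ell2 X) \<Longrightarrow> (\<lambda>x. \<Sum>i\<in>F. \<xi> i x) \<in> ell2 X"
  by (induction F rule: finite_induct) (auto simp: ell2_zero intro: ell2_add)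

lemma ell2_delta: "z \<in> X \<Longrightarrow> delta z \<in> ell2 X"
  unfolding ell2_def delta_def
  by (auto intro!: finite_nonzero_values_imp_summable_on finite_subset[of _ "{z}"] split: if_splits)

lemma ell2_mono:
  assumes "X \<subseteq> Y" "\<xi> \<in> ell2 X"
  shows "\<xi> \<in> ell2 Y" "ell2_norm Y \<xi> = ell2_norm X \<xi>"
proof -
  have "(\<lambda>x. (cmod (\<xi> x))\<^sup>2) summable_on Y \<longleftrightarrow> (\<lambda>x. (cmod (\<xi> x))\<^sup>2) summable_on X"
    by (rule summable_on_cong_neutral) (use assms in \<open>auto simp: ell2_def\<close>)
  then show "\<xi> \<in> ell2 Y" using assms by (auto simp: ell2_def)
  have "infsum (\<lambda>x. (cmod (\<xi> x))\<^sup>2) Y = infsum (\<lambda>x. (cmod (\<xi> x))\<^sup>2) X"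
    by (rule infsum_cong_neutral) (use assms in \<open>auto simp: ell2_def\<close>)
  then show "ell2_norm Y \<xi> = ell2_norm X \<xi>" by (simp add: ell2_norm_def)
qed

lemma ell2_restrict:
  assumes "\<xi> \<in> ell2 Y" "X \<subseteq> Y"
  shows "(\<lambda>x. if x \<in> X then \<xi> x else 0) \<in> ell2 X"
    and "(ell2_norm X (\<lambda>x. if x \<in> X then \<xi> x else 0))\<^sup>2 = (\<Sum>\<^sub>\<infinity>x\<in>X. (cmod (\<xi> x))\<^sup>2)"
proof -
  have s: "(\<lambda>x. (cmod (\<xi> x))\<^sup>2) summable_on X"
    using assms summable_on_subset_banach by (fastforce simp: ell2_def)
  have "(\<lambda>x. (cmod (if x \<in> X then \<xi> x else 0))\<^sup>2) summable_on X \<longleftrightarrow> 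
        (\<lambda>x. (cmod (\<xi> x))\<^sup>2) summable_on X"
    by (rule summable_on_cong) auto
  with s show "(\<lambda>x. if x \<in> X then \<xi> x else 0) \<in> ell2 X" by (simp add: ell2_def)
  have "(\<Sum>\<^sub>\<infinity>x\<in>X. (cmod (if x \<in> X then \<xi> x else 0))\<^sup>2) = (\<Sum>\<^sub>\<infinity>x\<in>X. (cmod (\<xi> x))\<^sup>2)"
    by (rule infsum_cong) auto
  then show "(ell2_norm X (\<lambda>x. if x \<in> X then \<xi> x else 0))\<^sup>2 = (\<Sum>\<^sub>\<infinity>x\<in>X. (cmod (\<xi> x))\<^sup>2)"
    by (simp add: ell2_norm_def infsum_nonneg)
qed

lemma truncation_eq_sum_delta:
  "finite F \<Longrightarrow> (\<lambda>x. if x \<in> F then \<xi> x else 0) = (\<lambda>x. \<Sum>z\<in>F. \<xi> z * delta z x)"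
  by (auto simp: delta_def fun_eq_iff if_distrib cong: if_cong)

lemma finite_truncation_dense:
  assumes "\<xi> \<in> ell2 X" "0 < e"
  obtains F where "finite F" "F \<subseteq> X"
    "ell2_norm X (\<lambda>x. \<xi> x - (if x \<in> F then \<xi> x else 0)) < e"
proof -
  let ?h = "\<lambda>x. (cmod (\<xi> x))\<^sup>2"
  have s: "?h summable_on X" using assms by (simp add: ell2_def)
  from infsum_finite_approximation[OF s, of "(e/2)\<^sup>2"] assms(2)
  obtain F where F: "finite F" "F \<subseteq> X" "dist (sum ?h F) (infsum ?h X) \<le> (e/2)\<^sup>2"
    by auto
  have "infsum ?h (X - F) = infsum ?h X - infsum ?h F"
    by (rule infsum_Diff) (use s F in auto)
  then have le: "infsum ?h (X - F) \<le> (e/2)\<^sup>2"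
    using F by (simp add: dist_real_def abs_if split: if_splits)
  have "infsum (\<lambda>x. (cmod (\<xi> x - (if x \<in> F then \<xi> x else 0)))\<^sup>2) X = infsum ?h (X - F)"
    by (rule infsum_cong_neutral) auto
  with le have "ell2_norm X (\<lambda>x. \<xi> x - (if x \<in> F then \<xi> x else 0)) \<le> e/2"
    using assms(2) unfolding ell2_norm_def by (intro real_le_lsqrt) (auto simp: infsum_nonneg)
  then show ?thesis using that F assms(2) by force
qed

text \<open>Finite linear combinations of point masses are dense, so a bounded linear functional is
  determined by its values on point masses. Applied to matrix coefficients, this
  shows that operators are determined by the images of point masses.\<close>

lemma functional_ext_on_delta:
  fixes \<phi> \<psi> :: "('a \<Rightarrow> complex) \<Rightarrow> complex"
  assumes add: "\<And>\<xi> \<eta>. \<xi> \<in> ell2 X \<Longrightarrow> \<eta> \<in> ell2 X \<Longrightarrow> \<phi> (\<lambda>x. \<xi> x + \<eta> x) = \<phi> \<xi> + \<phi> \<eta>"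
      "\<And>\<xi> \<eta>. \<xi> \<in> ell2 X \<Longrightarrow> \<eta> \<in> ell2 X \<Longrightarrow> \<psi> (\<lambda>x. \<xi> x + \<eta> x) = \<psi> \<xi> + \<psi> \<eta>"
    and scale: "\<And>c \<xi>. \<xi> \<in> ell2 X \<Longrightarrow> \<phi> (\<lambda>x. c * \<xi> x) = c * \<phi> \<xi>"
      "\<And>c \<xi>. \<xi> \<in> ell2 X \<Longrightarrow> \<psi> (\<lambda>x. c * \<xi> x) = c * \<psi> \<xi>"
    and bnd: "\<And>\<xi>. \<xi> \<in> ell2 X \<Longrightarrow> cmod (\<phi> \<xi>) \<le> C * ell2_norm X \<xi>"
      "\<And>\<xi>. \<xi> \<in> ell2 X \<Longrightarrow> cmod (\<psi> \<xi>) \<le> D * ell2_norm X \<xi>"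
    and delta: "\<And>z. z \<in> X \<Longrightarrow> \<phi> (delta z) = \<psi> (delta z)"
    and \<xi>: "\<xi> \<in> ell2 X"
  shows "\<phi> \<xi> = \<psi> \<xi>"
proof -
  define \<theta> where "\<theta> \<xi> = \<phi> \<xi> - \<psi> \<xi>" for \<xi>
  define E where "E = \<bar>C\<bar> + \<bar>D\<bar> + 1"
  have E: "E > 0" by (simp add: E_def)
  have a: "\<theta> (\<lambda>x. \<xi> x + \<eta> x) = \<theta> \<xi> + \<theta> \<eta>" if "\<xi> \<in> ell2 X" "\<eta> \<in> ell2 X" for \<xi> \<eta>
    using add that by (simp add: \<theta>_def)
  have s: "\<theta> (\<lambda>x. c * \<xi> x) = c * \<theta> \<xi>" if "\<xi> \<in> ell2 X" for c \<xi>
    using scale that by (simp add: \<theta>_def algebra_simps)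
  have b: "cmod (\<theta> \<xi>) \<le> E * ell2_norm X \<xi>" if "\<xi> \<in> ell2 X" for \<xi>
  proof -
    have "cmod (\<theta> \<xi>) \<le> cmod (\<phi> \<xi>) + cmod (\<psi> \<xi>)"
      unfolding \<theta>_def by (rule norm_triangle_ineq4)
    also have "\<dots> \<le> (C + D) * ell2_norm X \<xi>" using bnd that by (force simp: algebra_simps)
    also have "\<dots> \<le> E * ell2_norm X \<xi>"
      by (rule mult_right_mono) (auto simp: E_def ell2_norm_nonneg)
    finally show ?thesis .
  qed
  have z: "\<theta> (\<lambda>x. 0) = 0" using s[OF ell2_zero, of 0] by simp
  have fin: "\<theta> (\<lambda>x. \<Sum>z\<in>F. \<eta> z * delta z x) = 0" if "finite F" "F \<subseteq> X" for F \<eta>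
    using that
  proof (induction F rule: finite_induct)
    case empty
    then show ?case using z by simp
  next
    case (insert y F)
    have "\<theta> (delta y) = 0" using delta insert.prems by (simp add: \<theta>_def)
    moreover have "\<theta> (\<lambda>x. \<Sum>z\<in>insert y F. \<eta> z * delta z x)
        = \<theta> (\<lambda>x. \<eta> y * delta y x) + \<theta> (\<lambda>x. \<Sum>z\<in>F. \<eta> z * delta z x)"
      using insert by (simp add: a ell2_scale ell2_delta ell2_sum subset_iff)
    ultimately show ?case using insert by (simp add: s ell2_delta)
  qed
  have "cmod (\<theta> \<xi>) \<le> E * e" if e0: "e > 0" for e
  proof -
    obtain F where F: "finite F" "F \<subseteq> X"
      "ell2_norm X (\<lambda>x. \<xi> x - (if x \<in> F then \<xi> x else 0)) < e"
      using finite_truncation_dense[OF \<xi> e0] .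
    let ?t = "\<lambda>x. if x \<in> F then \<xi> x else 0"
    have t: "?t = (\<lambda>x. \<Sum>z\<in>F. \<xi> z * delta z x)" by (rule truncation_eq_sum_delta[OF F(1)])
    have t2: "?t \<in> ell2 X" unfolding t
      by (rule ell2_sum) (use F in \<open>auto intro: ell2_scale ell2_delta\<close>)
    have "\<theta> \<xi> = \<theta> (\<lambda>x. \<xi> x - ?t x) + \<theta> ?t"
      using a[OF ell2_diff[OF \<xi> t2] t2] by simp
    also have "\<theta> ?t = 0" unfolding t by (rule fin[OF F(1,2)])
    finally have "cmod (\<theta> \<xi>) \<le> E * ell2_norm X (\<lambda>x. \<xi> x - ?t x)"
      using b[OF ell2_diff[OF \<xi> t2]] by simp
    also have "\<dots> \<le> E * e" using F E by simp
    finally show ?thesis .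
  qed
  then have "cmod (\<theta> \<xi>) \<le> 0 + d" if "d > 0" for d
    using that E by (metis add_0 divide_pos_pos nonzero_mult_div_cancel_left order_less_irrefl times_divide_eq_right)
  then have "cmod (\<theta> \<xi>) \<le> 0" by (rule field_le_epsilon)
  then show ?thesis by (simp add: \<theta>_def)
qed

lemma ell2_inner_abs_summable:
  assumes "\<xi> \<in> ell2 X" "\<eta> \<in> ell2 X"
  shows "(\<lambda>x. cmod (\<xi> x * cnj (\<eta> x))) summable_on X"
    and "cmod (ell2_inner X \<xi> \<eta>) \<le> ell2_norm X \<xi> * ell2_norm X \<eta>"
proof -
  have fin: "(\<Sum>x\<in>F. cmod (\<xi> x * cnj (\<eta> x))) \<le> ell2_norm X \<xi> * ell2_norm X \<eta>"
    if F: "finite F" "F \<subseteq> X" for F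
  proof -
    have "(\<Sum>x\<in>F. cmod (\<xi> x * cnj (\<eta> x))) \<le> L2_set (\<lambda>x. cmod (\<xi> x)) F * L2_set (\<lambda>x. cmod (\<eta> x)) F"
      using L2_set_mult_ineq[of "\<lambda>x. cmod (\<xi> x)" "\<lambda>x. cmod (\<eta> x)" F] by (simp add: norm_mult)
    also have "\<dots> \<le> ell2_norm X \<xi> * ell2_norm X \<eta>"
      using assms F by (intro mult_mono L2_set_le_ell2_norm) (auto simp: ell2_norm_nonneg)
    finally show ?thesis .
  qed
  show s: "(\<lambda>x. cmod (\<xi> x * cnj (\<eta> x))) summable_on X"
    by (rule nonneg_bdd_above_summable_on) (use fin in \<open>auto simp: bdd_above_def\<close>)
  show "cmod (ell2_inner X \<xi> \<eta>) \<le> ell2_norm X \<xi> * ell2_norm X \<eta>"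
    unfolding ell2_inner_def
    using norm_infsum_bound[OF s] infsum_le_finite_sums[OF s fin] by force
qed

lemma ell2_inner_add_left:
  assumes "\<xi> \<in> ell2 X" "\<xi>' \<in> ell2 X" "\<eta> \<in> ell2 X"
  shows "ell2_inner X (\<lambda>x. \<xi> x + \<xi>' x) \<eta> = ell2_inner X \<xi> \<eta> + ell2_inner X \<xi>' \<eta>"
  unfolding ell2_inner_def distrib_right
  by (rule infsum_add) (use assms in \<open>blast intro: abs_summable_summable ell2_inner_abs_summable(1)\<close>)+

lemma ell2_inner_scale_left: "ell2_inner X (\<lambda>x. c * \<xi> x) \<eta> = c * ell2_inner X \<xi> \<eta>"
  by (simp add: ell2_inner_def mult.assoc infsum_cmult_right')

lemma ell2_inner_commute: "ell2_inner X \<eta> \<xi> = cnj (ell2_inner X \<xi> \<eta>)"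
  by (simp add: ell2_inner_def infsum_cnj[symmetric] mult.commute)

lemma ell2_inner_delta:
  assumes "z \<in> X"
  shows "ell2_inner X (delta z) \<eta> = cnj (\<eta> z)"
proof -
  have "ell2_inner X (delta z) \<eta> = infsum (\<lambda>x. delta z x * cnj (\<eta> x)) {z}"
    unfolding ell2_inner_def by (rule infsum_cong_neutral) (use assms in \<open>auto simp: delta_def\<close>)
  then show ?thesis by (simp add: delta_def)
qed

section \<open>The complete *-algebra of bounded operators\<close>

lemma bounded_opsD:
  assumes "T \<in> bounded_ops X"
  shows "\<xi> \<in> ell2 X \<Longrightarrow> T \<xi> \<in> ell2 X"
    and "\<xi> \<in> ell2 X \<Longrightarrow> \<eta> \<in> ell2 X \<Longrightarrow> T (\<lambda>x. \<xi> x + \<eta> x) = (\<lambda>x. T \<xi> x + T \<eta> x)"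
    and "\<xi> \<in> ell2 X \<Longrightarrow> T (\<lambda>x. c * \<xi> x) = (\<lambda>x. c * T \<xi> x)"
    and "\<xi> \<notin> ell2 X \<Longrightarrow> T \<xi> = undefined"
  using assms by (auto simp: bounded_ops_def PiE_def extensional_def)

lemma bounded_opsI:
  assumes "\<And>\<xi>. \<xi> \<in> ell2 X \<Longrightarrow> T \<xi> \<in> ell2 X"
    and "\<And>\<xi> \<eta>. \<xi> \<in> ell2 X \<Longrightarrow> \<eta> \<in> ell2 X \<Longrightarrow> T (\<lambda>x. \<xi> x + \<eta> x) = (\<lambda>x. T \<xi> x + T \<eta> x)"
    and "\<And>c \<xi>. \<xi> \<in> ell2 X \<Longrightarrow> T (\<lambda>x. c * \<xi> x) = (\<lambda>x. c * T \<xi> x)"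
    and "\<And>\<xi>. \<xi> \<in> ell2 X \<Longrightarrow> ell2_norm X (T \<xi>) \<le> C * ell2_norm X \<xi>"
  shows "restrict T (ell2 X) \<in> bounded_ops X"
  unfolding bounded_ops_def using assms by (auto simp: ell2_add(1) ell2_scale intro!: exI[of _ C])

lemma op_norm_bdd:
  assumes "T \<in> bounded_ops X"
  shows "bdd_above ((\<lambda>\<xi>. ell2_norm X (T \<xi>)) ` {\<xi> \<in> ell2 X. ell2_norm X \<xi> \<le> 1})"
proof -
  obtain C where C: "\<And>\<xi>. \<xi> \<in> ell2 X \<Longrightarrow> ell2_norm X (T \<xi>) \<le> C * ell2_norm X \<xi>"
    using assms unfolding bounded_ops_def by blast
  have "ell2_norm X (T \<xi>) \<le> \<bar>C\<bar>" if "\<xi> \<in> ell2 X" "ell2_norm X \<xi> \<le> 1" for \<xi>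
  proof -
    have "C * ell2_norm X \<xi> \<le> \<bar>C\<bar> * 1"
      using that ell2_norm_nonneg[of X \<xi>] by (intro mult_mono) auto
    then show ?thesis using C[OF that(1)] by simp
  qed
  then show ?thesis by (auto simp: bdd_above_def)
qed

lemma op_norm_nonneg:
  assumes "T \<in> bounded_ops X"
  shows "0 \<le> op_norm X T"
proof -
  have "(\<lambda>x. 0) \<in> {\<xi> \<in> ell2 X. ell2_norm X \<xi> \<le> 1}" by (simp add: ell2_zero ell2_norm_def)
  from cSUP_upper[OF this op_norm_bdd[OF assms]] show ?thesis
    unfolding op_norm_def by (meson ell2_norm_nonneg order_trans)
qed

lemma op_norm_bound:
  assumes T: "T \<in> bounded_ops X" and \<xi>: "\<xi> \<in> ell2 X"
  shows "ell2_norm X (T \<xi>) \<le> op_norm X T * ell2_norm X \<xi>"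
proof (cases "ell2_norm X \<xi> = 0")
  case True
  then have 0: "\<xi> = (\<lambda>x. 0 * \<xi> x)" using ell2_norm_zero_iff[OF \<xi>] by simp
  have "T \<xi> = (\<lambda>x. 0)" by (subst 0, subst bounded_opsD(3)[OF T \<xi>]) simp
  then show ?thesis using True by (simp add: ell2_norm_def)
next
  case False
  define n where "n = ell2_norm X \<xi>"
  have n: "n > 0" using False ell2_norm_nonneg[of X \<xi>] by (simp add: n_def)
  let ?\<eta> = "\<lambda>x. complex_of_real (1/n) * \<xi> x"
  have "?\<eta> \<in> {\<xi> \<in> ell2 X. ell2_norm X \<xi> \<le> 1}"
    using \<xi> n by (simp add: ell2_scale ell2_norm_scale norm_divide n_def[symmetric] del: of_real_divide)
  from cSUP_upper[OF this op_norm_bdd[OF T]]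
  have "ell2_norm X (T ?\<eta>) \<le> op_norm X T" by (simp add: op_norm_def)
  moreover have "ell2_norm X (T ?\<eta>) = ell2_norm X (T \<xi>) / n"
    unfolding bounded_opsD(3)[OF T \<xi>] ell2_norm_scale using n by (simp add: norm_divide)
  ultimately have "ell2_norm X (T \<xi>) / n \<le> op_norm X T" by simp
  then show ?thesis using n by (simp add: pos_divide_le_eq n_def[symmetric])
qed

lemma op_norm_le:
  assumes "0 \<le> C" and "\<And>\<xi>. \<xi> \<in> ell2 X \<Longrightarrow> ell2_norm X (T \<xi>) \<le> C * ell2_norm X \<xi>"
  shows "op_norm X T \<le> C"
  unfolding op_norm_def
proof (rule cSUP_least)
  show "{\<xi> \<in> ell2 X. ell2_norm X \<xi> \<le> 1} \<noteq> {}"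
    using ell2_zero[of X] by (force simp: ell2_norm_def)
  fix \<xi> assume \<xi>: "\<xi> \<in> {\<xi> \<in> ell2 X. ell2_norm X \<xi> \<le> 1}"
  then have "C * ell2_norm X \<xi> \<le> C * 1" using assms(1) by (intro mult_left_mono) auto
  then show "ell2_norm X (T \<xi>) \<le> C" using assms(2)[of \<xi>] \<xi> by auto
qed

lemma bounded_op_ext_on_delta:
  assumes S: "S \<in> bounded_ops X" and T: "T \<in> bounded_ops X"
    and eq: "\<And>z. z \<in> X \<Longrightarrow> S (delta z) = T (delta z)"
  shows "S = T"
proof
  fix \<xi>
  show "S \<xi> = T \<xi>"
  proof (cases "\<xi> \<in> ell2 X")
    case True
    have b: "cmod (R \<zeta> w) \<le> op_norm X R * ell2_norm X \<zeta>" 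
      if "R \<in> bounded_ops X" "\<zeta> \<in> ell2 X" for R \<zeta> w
      using cmod_le_ell2_norm[OF bounded_opsD(1)[OF that]] op_norm_bound[OF that]
      by (meson order_trans)
    have "S \<xi> w = T \<xi> w" for w
      by (rule functional_ext_on_delta[where X = X and \<phi> = "\<lambda>\<xi>. S \<xi> w" and \<psi> = "\<lambda>\<xi>. T \<xi> w",
            OF _ _ _ _ b[OF S] b[OF T]])
        (simp_all add: True eq bounded_opsD[OF S] bounded_opsD[OF T])
    then show ?thesis ..
  qed (simp add: bounded_opsD(4)[OF S] bounded_opsD(4)[OF T])
qed

lemma op_algebra_simps [simp]:
  "carr (op_algebra X) = bounded_ops X"
  "aadd (op_algebra X) S T = (\<lambda>\<xi>\<in>ell2 X. \<lambda>x. S \<xi> x + T \<xi> x)"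
  "ascale (op_algebra X) c T = (\<lambda>\<xi>\<in>ell2 X. \<lambda>x. c * T \<xi> x)"
  "amult (op_algebra X) S T = compose (ell2 X) S T"
  "astar (op_algebra X) = adjoint_op X"
  "nrm (op_algebra X) = op_norm X"
  by (simp_all add: op_algebra_def)

lemma bounded_ops_add:
  assumes S: "S \<in> bounded_ops X" and T: "T \<in> bounded_ops X"
  shows "(\<lambda>\<xi>\<in>ell2 X. \<lambda>x. S \<xi> x + T \<xi> x) \<in> bounded_ops X"
proof (rule bounded_opsI[where C = "op_norm X S + op_norm X T"])
  fix \<xi> assume \<xi>: "\<xi> \<in> ell2 X"
  note m = bounded_opsD(1)[OF S \<xi>] bounded_opsD(1)[OF T \<xi>]
  show "(\<lambda>x. S \<xi> x + T \<xi> x) \<in> ell2 X" by (rule ell2_add(1)[OF m])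
  show "ell2_norm X (\<lambda>x. S \<xi> x + T \<xi> x) \<le> (op_norm X S + op_norm X T) * ell2_norm X \<xi>"
    using ell2_add(2)[OF m] op_norm_bound[OF S \<xi>] op_norm_bound[OF T \<xi>]
    by (simp add: distrib_right)
qed (simp_all add: bounded_opsD[OF S] bounded_opsD[OF T] algebra_simps)

lemma bounded_ops_scale:
  assumes T: "T \<in> bounded_ops X"
  shows "(\<lambda>\<xi>\<in>ell2 X. \<lambda>x. c * T \<xi> x) \<in> bounded_ops X"
proof (rule bounded_opsI[where C = "cmod c * op_norm X T"])
  fix \<xi> assume \<xi>: "\<xi> \<in> ell2 X"
  show "ell2_norm X (\<lambda>x. c * T \<xi> x) \<le> cmod c * op_norm X T * ell2_norm X \<xi>"
    using op_norm_bound[OF T \<xi>] by (simp add: ell2_norm_scale mult.assoc mult_left_mono)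
qed (simp_all add: bounded_opsD[OF T] ell2_scale algebra_simps)

lemma bounded_ops_compose:
  assumes S: "S \<in> bounded_ops X" and T: "T \<in> bounded_ops X"
  shows "compose (ell2 X) S T \<in> bounded_ops X"
  unfolding compose_def
proof (rule bounded_opsI[where C = "op_norm X S * op_norm X T"])
  fix \<xi> assume \<xi>: "\<xi> \<in> ell2 X"
  show "ell2_norm X (S (T \<xi>)) \<le> op_norm X S * op_norm X T * ell2_norm X \<xi>"
    using op_norm_bound[OF S bounded_opsD(1)[OF T \<xi>]]
      mult_left_mono[OF op_norm_bound[OF T \<xi>] op_norm_nonneg[OF S]] by (simp add: mult.assoc)
qed (simp_all add: bounded_opsD[OF T] bounded_opsD[OF S])

lemma dist_op_bound:
  assumes S: "S \<in> bounded_ops X" and T: "T \<in> bounded_ops X" and \<xi>: "\<xi> \<in> ell2 X"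
  shows "ell2_norm X (\<lambda>x. S \<xi> x - T \<xi> x) \<le> dist_in (op_algebra X) S T * ell2_norm X \<xi>"
  using op_norm_bound[OF bounded_ops_add[OF S bounded_ops_scale[OF T, of "-1"]] \<xi>] \<xi>
  by (simp add: dist_in_def)

lemma dist_op_le:
  assumes "0 \<le> C"
    and "\<And>\<xi>. \<xi> \<in> ell2 X \<Longrightarrow> ell2_norm X (\<lambda>x. S \<xi> x - T \<xi> x) \<le> C * ell2_norm X \<xi>"
  shows "dist_in (op_algebra X) S T \<le> C"
  unfolding dist_in_def op_algebra_simps by (rule op_norm_le) (use assms in simp_all)

lemma dist_op_nonneg:
  assumes "S \<in> bounded_ops X" "T \<in> bounded_ops X"
  shows "0 \<le> dist_in (op_algebra X) S T"
  unfolding dist_in_def op_algebra_simps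
  by (intro op_norm_nonneg bounded_ops_add bounded_ops_scale assms)

lemma ell2_inner_self:
  assumes \<xi>: "\<xi> \<in> ell2 X"
  shows "ell2_inner X \<xi> \<xi> = complex_of_real ((ell2_norm X \<xi>)\<^sup>2)"
proof -
  have "ell2_inner X \<xi> \<xi> = (\<Sum>\<^sub>\<infinity>x\<in>X. complex_of_real ((cmod (\<xi> x))\<^sup>2))"
    unfolding ell2_inner_def by (rule infsum_cong) (metis complex_norm_square)
  also have "\<dots> = complex_of_real (\<Sum>\<^sub>\<infinity>x\<in>X. (cmod (\<xi> x))\<^sup>2)"
    using \<xi> has_sum_infsum[of "\<lambda>x. (cmod (\<xi> x))\<^sup>2" X]
    by (intro infsumI) (simp only: has_sum_of_real_iff ell2_def mem_Collect_eq)
  finally show ?thesis by (simp add: ell2_norm_def infsum_nonneg)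
qed

text \<open>The value at \<open>x\<close> of the adjoint applied to \<open>\<eta>\<close> is forced to be the conjugate of
  \<open>\<langle>T \<delta>\<^sub>x, \<eta>\<rangle>\<close>; testing \<open>T\<close> on finite truncations of this function shows that it is
  square-summable. This is the Riesz representation theorem in coordinates.\<close>

lemma adjoint_exists:
  assumes T: "T \<in> bounded_ops X"
  obtains S where "S \<in> bounded_ops X"
    "\<And>\<xi> \<eta>. \<xi> \<in> ell2 X \<Longrightarrow> \<eta> \<in> ell2 X \<Longrightarrow> ell2_inner X (T \<xi>) \<eta> = ell2_inner X \<xi> (S \<eta>)"
proof -
  define S where "S \<eta> x = (if x \<in> X then cnj (ell2_inner X (T (delta x)) \<eta>) else 0)" for \<eta> x
  note TD = bounded_opsD(1)[OF T]
  have bT: "cmod (ell2_inner X (T \<xi>) \<eta>) \<le> (op_norm X T * ell2_norm X \<eta>) * ell2_norm X \<xi>"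
    if "\<xi> \<in> ell2 X" "\<eta> \<in> ell2 X" for \<xi> \<eta>
    using ell2_inner_abs_summable(2)[OF TD[OF that(1)] that(2)]
      mult_right_mono[OF op_norm_bound[OF T that(1)] ell2_norm_nonneg[of X \<eta>]]
    by (simp add: mult_ac)
  have addT: "ell2_inner X (T (\<lambda>x. \<xi> x + \<xi>' x)) \<eta> = ell2_inner X (T \<xi>) \<eta> + ell2_inner X (T \<xi>') \<eta>"
    if "\<xi> \<in> ell2 X" "\<xi>' \<in> ell2 X" "\<eta> \<in> ell2 X" for \<xi> \<xi>' \<eta>
    using that by (simp add: bounded_opsD(2)[OF T] ell2_inner_add_left TD)
  have scT: "ell2_inner X (T (\<lambda>x. c * \<xi> x)) \<eta> = c * ell2_inner X (T \<xi>) \<eta>"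
    if "\<xi> \<in> ell2 X" for c \<xi> \<eta>
    using that by (simp add: bounded_opsD(3)[OF T] ell2_inner_scale_left)
  have Sn: "L2_set (\<lambda>x. cmod (S \<eta> x)) F \<le> op_norm X T * ell2_norm X \<eta>"
    if F: "finite F" "F \<subseteq> X" and \<eta>: "\<eta> \<in> ell2 X" for F \<eta>
  proof -
    define \<zeta> where "\<zeta> = (\<lambda>x. if x \<in> F then S \<eta> x else 0)"
    define l where "l = L2_set (\<lambda>x. cmod (S \<eta> x)) F"
    have l0: "l \<ge> 0" by (simp add: l_def)
    have \<zeta>: "\<zeta> \<in> ell2 F" using F by (simp add: ell2_def \<zeta>_def)
    have "(\<Sum>x\<in>F. (cmod (if x \<in> F then S \<eta> x else 0))\<^sup>2) = (\<Sum>x\<in>F. (cmod (S \<eta> x))\<^sup>2)"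
      by (rule sum.cong) auto
    then have nl: "ell2_norm F \<zeta> = l" using F by (simp add: ell2_norm_def \<zeta>_def l_def L2_set_def)
    note mono = ell2_mono[OF F(2)]
    have "ell2_inner X (T \<zeta>) \<eta> = (\<Sum>x\<in>F. \<zeta> x * cnj (S \<eta> x))"
    proof (rule functional_ext_on_delta[where X = F and \<phi> = "\<lambda>\<xi>. ell2_inner X (T \<xi>) \<eta>"
          and \<psi> = "\<lambda>\<xi>. \<Sum>x\<in>F. \<xi> x * cnj (S \<eta> x)"])
      fix \<xi> assume \<xi>: "\<xi> \<in> ell2 F"
      show "cmod (ell2_inner X (T \<xi>) \<eta>) \<le> (op_norm X T * ell2_norm X \<eta>) * ell2_norm F \<xi>"
        using bT[OF mono(1)[OF \<xi>] \<eta>] mono(2)[OF \<xi>] by simp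
      have "cmod (\<Sum>x\<in>F. \<xi> x * cnj (S \<eta> x)) \<le> (\<Sum>x\<in>F. cmod (S \<eta> x) * ell2_norm F \<xi>)"
        by (rule sum_norm_le) 
          (simp add: norm_mult mult.commute[of "cmod (S _ _)"] mult_right_mono cmod_le_ell2_norm[OF \<xi>])
      then show "cmod (\<Sum>x\<in>F. \<xi> x * cnj (S \<eta> x)) \<le> (\<Sum>x\<in>F. cmod (S \<eta> x)) * ell2_norm F \<xi>"
        by (simp add: sum_distrib_right)
    next
      fix z assume z: "z \<in> F"
      then have "(\<Sum>x\<in>F. delta z x * cnj (S \<eta> x)) = cnj (S \<eta> z)"
        using F by (simp add: delta_def if_distrib[of "\<lambda>t. t * _"] cong: if_cong)
      then show "ell2_inner X (T (delta z)) \<eta> = (\<Sum>x\<in>F. delta z x * cnj (S \<eta> x))"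
        using z F by (auto simp: S_def)
    qed (simp_all add: mono(1) \<eta> addT scT \<zeta> sum.distrib distrib_right sum_distrib_left mult.assoc)
    also have "\<dots> = (\<Sum>x\<in>F. complex_of_real ((cmod (S \<eta> x))\<^sup>2))"
      by (rule sum.cong[OF refl]) (unfold \<zeta>_def, metis complex_norm_square)
    also have "\<dots> = complex_of_real (l\<^sup>2)" by (simp add: l_def L2_set_def sum_nonneg)
    finally have "l\<^sup>2 \<le> (op_norm X T * ell2_norm X \<eta>) * l"
      using bT[OF mono(1)[OF \<zeta>] \<eta>] mono(2)[OF \<zeta>] nl l0 by (simp add: norm_power)
    then have "l = 0 \<or> l \<le> op_norm X T * ell2_norm X \<eta>"
      using l0 by (metis less_eq_real_def mult_le_cancel_right_pos power2_eq_square)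
    then show ?thesis
      using op_norm_nonneg[OF T] ell2_norm_nonneg[of X \<eta>] by (auto simp: l_def)
  qed
  have S2: "S \<eta> \<in> ell2 X" "ell2_norm X (S \<eta>) \<le> op_norm X T * ell2_norm X \<eta>"
    if "\<eta> \<in> ell2 X" for \<eta>
    using ell2_boundI[of X "S \<eta>" "op_norm X T * ell2_norm X \<eta>", OF _ Sn] that
    by (auto simp: S_def)
  have comm: "S \<eta> x = (if x \<in> X then ell2_inner X \<eta> (T (delta x)) else 0)" for \<eta> x
    by (simp add: S_def ell2_inner_commute[of X _ \<eta>])
  have "restrict S (ell2 X) \<in> bounded_ops X"
    by (rule bounded_opsI[where C = "op_norm X T"])
      (auto simp: S2 fun_eq_iff comm ell2_inner_add_left ell2_inner_scale_left TD ell2_delta)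
  moreover have "ell2_inner X (T \<xi>) \<eta> = ell2_inner X \<xi> (restrict S (ell2 X) \<eta>)"
    if \<xi>: "\<xi> \<in> ell2 X" and \<eta>: "\<eta> \<in> ell2 X" for \<xi> \<eta>
  proof -
    have b: "cmod (ell2_inner X \<xi> (S \<eta>)) \<le> ell2_norm X (S \<eta>) * ell2_norm X \<xi>" if "\<xi> \<in> ell2 X" for \<xi>
      using ell2_inner_abs_summable(2)[OF that S2(1)[OF \<eta>]] by (simp add: mult.commute)
    have "ell2_inner X (T \<xi>) \<eta> = ell2_inner X \<xi> (S \<eta>)"
      by (rule functional_ext_on_delta[where X = X and \<phi> = "\<lambda>\<xi>. ell2_inner X (T \<xi>) \<eta>"
          and \<psi> = "\<lambda>\<xi>. ell2_inner X \<xi> (S \<eta>)", OF _ _ _ _ bT[OF _ \<eta>] b])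
        (use \<eta> \<xi> in \<open>simp_all add: addT scT ell2_inner_add_left S2 ell2_inner_scale_left 
            ell2_inner_delta S_def\<close>)
    then show ?thesis using \<eta> by simp
  qed
  ultimately show ?thesis using that by blast
qed

lemma adjoint_unique:
  assumes "S \<in> bounded_ops X" "S' \<in> bounded_ops X"
    and "\<And>\<xi> \<eta>. \<xi> \<in> ell2 X \<Longrightarrow> \<eta> \<in> ell2 X \<Longrightarrow> ell2_inner X \<xi> (S \<eta>) = ell2_inner X \<xi> (S' \<eta>)"
  shows "S = S'"
proof (rule bounded_op_ext_on_delta[OF assms(1,2)])
  fix z assume z: "z \<in> X"
  have "S (delta z) x = S' (delta z) x" for x
  proof (cases "x \<in> X")
    case True
    then show ?thesis
      using assms(3)[OF ell2_delta[OF True] ell2_delta[OF z]] by (simp add: ell2_inner_delta)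
  next
    case False
    then show ?thesis
      using assms(1,2) z by (metis bounded_opsD(1) ell2_delta ell2_vanishes)
  qed
  then show "S (delta z) = S' (delta z)" ..
qed

lemma adjoint_op:
  assumes T: "T \<in> bounded_ops X"
  shows "adjoint_op X T \<in> bounded_ops X"
    and "\<And>\<xi> \<eta>. \<xi> \<in> ell2 X \<Longrightarrow> \<eta> \<in> ell2 X \<Longrightarrow>
      ell2_inner X (T \<xi>) \<eta> = ell2_inner X \<xi> (adjoint_op X T \<eta>)"
proof -
  obtain S where S: "S \<in> bounded_ops X"
    "\<And>\<xi> \<eta>. \<xi> \<in> ell2 X \<Longrightarrow> \<eta> \<in> ell2 X \<Longrightarrow> ell2_inner X (T \<xi>) \<eta> = ell2_inner X \<xi> (S \<eta>)"
    using adjoint_exists[OF T] by blast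
  have "adjoint_op X T = S"
    unfolding adjoint_op_def
    by (rule the_equality) (use S in \<open>auto intro!: adjoint_unique[of _ X]\<close>)
  with S show "adjoint_op X T \<in> bounded_ops X"
    "\<And>\<xi> \<eta>. \<xi> \<in> ell2 X \<Longrightarrow> \<eta> \<in> ell2 X \<Longrightarrow>
      ell2_inner X (T \<xi>) \<eta> = ell2_inner X \<xi> (adjoint_op X T \<eta>)" by auto
qed

text \<open>With \<open>\<zeta> = S\<^sup>* \<eta> - T\<^sup>* \<eta>\<close> one has \<open>\<parallel>\<zeta>\<parallel>\<^sup>2 = \<langle>(S - T) \<zeta>, \<eta>\<rangle>\<close>, and one factor \<open>\<parallel>\<zeta>\<parallel>\<close>
  cancels.\<close>

lemma dist_adjoint_le:
  assumes S: "S \<in> bounded_ops X" and T: "T \<in> bounded_ops X"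
  shows "dist_in (op_algebra X) (adjoint_op X S) (adjoint_op X T) \<le> dist_in (op_algebra X) S T"
proof (rule dist_op_le[OF dist_op_nonneg[OF S T]])
  fix \<eta> assume \<eta>: "\<eta> \<in> ell2 X"
  let ?d = "dist_in (op_algebra X) S T"
  define \<zeta> where "\<zeta> = (\<lambda>x. adjoint_op X S \<eta> x - adjoint_op X T \<eta> x)"
  note m = bounded_opsD(1)[OF adjoint_op(1)[OF S] \<eta>] bounded_opsD(1)[OF adjoint_op(1)[OF T] \<eta>]
  have \<zeta>: "\<zeta> \<in> ell2 X" unfolding \<zeta>_def by (rule ell2_diff[OF m])
  note ST = bounded_opsD(1)[OF S \<zeta>] bounded_opsD(1)[OF T \<zeta>]
  have minus: "ell2_inner X (\<lambda>x. \<alpha> x - \<beta> x) \<gamma> = ell2_inner X \<alpha> \<gamma> - ell2_inner X \<beta> \<gamma>"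
    if "\<alpha> \<in> ell2 X" "\<beta> \<in> ell2 X" "\<gamma> \<in> ell2 X" for \<alpha> \<beta> \<gamma>
    using ell2_inner_add_left[OF that(1) ell2_scale[OF that(2), of "-1"] that(3)]
      ell2_inner_scale_left[of X "-1" \<beta> \<gamma>] by simp
  have "ell2_inner X \<zeta> \<zeta> = cnj (ell2_inner X (adjoint_op X S \<eta>) \<zeta> - ell2_inner X (adjoint_op X T \<eta>) \<zeta>)"
    using minus[OF m \<zeta>] ell2_inner_commute[of X \<zeta> \<zeta>] by (simp add: \<zeta>_def[symmetric])
  also have "\<dots> = ell2_inner X (S \<zeta>) \<eta> - ell2_inner X (T \<zeta>) \<eta>"
    using adjoint_op(2)[OF S \<zeta> \<eta>] adjoint_op(2)[OF T \<zeta> \<eta>]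
    by (simp add: ell2_inner_commute[of X _ \<zeta>])
  also have "\<dots> = ell2_inner X (\<lambda>x. S \<zeta> x - T \<zeta> x) \<eta>"
    by (rule minus[symmetric]) (simp_all add: ST \<eta>)
  finally have "cmod (ell2_inner X \<zeta> \<zeta>) \<le> ell2_norm X (\<lambda>x. S \<zeta> x - T \<zeta> x) * ell2_norm X \<eta>"
    using ell2_inner_abs_summable(2)[OF ell2_diff[OF ST] \<eta>] by simp
  also have "\<dots> \<le> (?d * ell2_norm X \<zeta>) * ell2_norm X \<eta>"
    by (intro mult_right_mono dist_op_bound S T \<zeta> ell2_norm_nonneg)
  finally have "(ell2_norm X \<zeta>)\<^sup>2 \<le> (?d * ell2_norm X \<eta>) * ell2_norm X \<zeta>"
    by (simp add: ell2_inner_self[OF \<zeta>] norm_power mult_ac)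
  then have "ell2_norm X \<zeta> = 0 \<or> ell2_norm X \<zeta> \<le> ?d * ell2_norm X \<eta>"
    using ell2_norm_nonneg[of X \<zeta>]
    by (metis less_eq_real_def mult_le_cancel_right_pos power2_eq_square)
  then show "ell2_norm X (\<lambda>x. adjoint_op X S \<eta> x - adjoint_op X T \<eta> x) \<le> ?d * ell2_norm X \<eta>"
    using dist_op_nonneg[OF S T] ell2_norm_nonneg[of X \<eta>] by (auto simp: \<zeta>_def[symmetric])
qed

text \<open>A Cauchy sequence of operators converges in every matrix coefficient; the uniform
  estimates, which involve finitely many coordinates at a time, pass to the pointwise limit.\<close>

lemma bounded_ops_complete:
  assumes s: "s \<in> Cauchy_seqs (op_algebra X)"
  obtains T where "T \<in> bounded_ops X" "(\<lambda>n. dist_in (op_algebra X) (s n) T) \<longlonglongrightarrow> 0"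
proof -
  let ?d = "dist_in (op_algebra X)"
  have b: "\<And>n. s n \<in> bounded_ops X" using s by (simp add: Cauchy_seqs_def)
  have C: "\<exists>N. \<forall>m\<ge>N. \<forall>n\<ge>N. ?d (s m) (s n) < e" if "e > 0" for e
    using s that by (simp add: Cauchy_seqs_def)
  define T where "T \<xi> x = lim (\<lambda>n. s n \<xi> x)" for \<xi> x
  have lim: "(\<lambda>n. s n \<xi> x) \<longlonglongrightarrow> T \<xi> x" if \<xi>: "\<xi> \<in> ell2 X" for \<xi> x
  proof -
    have "Cauchy (\<lambda>n. s n \<xi> x)"
    proof (rule metric_CauchyI)
      fix e :: real assume e: "e > 0"
      define n where "n = ell2_norm X \<xi> + 1"
      have n: "n > 0" using ell2_norm_nonneg[of X \<xi>] by (simp add: n_def)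
      obtain N where N: "\<And>m k. m \<ge> N \<Longrightarrow> k \<ge> N \<Longrightarrow> ?d (s m) (s k) < e / n"
        using C[of "e / n"] e n by auto
      have "dist (s m \<xi> x) (s k \<xi> x) < e" if mk: "m \<ge> N" "k \<ge> N" for m k
      proof -
        have "cmod (s m \<xi> x - s k \<xi> x) \<le> ell2_norm X (\<lambda>x. s m \<xi> x - s k \<xi> x)"
          using \<xi> by (intro cmod_le_ell2_norm ell2_diff bounded_opsD(1)[OF b])
        also have "\<dots> \<le> ?d (s m) (s k) * ell2_norm X \<xi>" by (rule dist_op_bound[OF b b \<xi>])
        also have "\<dots> \<le> ?d (s m) (s k) * n"
          using dist_op_nonneg[OF b b] by (intro mult_left_mono) (auto simp: n_def)
        also have "\<dots> < e" using N[OF mk] n by (simp add: field_simps)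
        finally show ?thesis by (simp add: dist_norm)
      qed
      then show "\<exists>M. \<forall>m\<ge>M. \<forall>n\<ge>M. dist (s m \<xi> x) (s n \<xi> x) < e" by blast
    qed
    then show ?thesis unfolding T_def using Cauchy_convergent convergent_LIMSEQ_iff by blast
  qed
  have near: "(\<lambda>x. s n \<xi> x - T \<xi> x) \<in> ell2 X \<and>
      ell2_norm X (\<lambda>x. s n \<xi> x - T \<xi> x) \<le> e * ell2_norm X \<xi>"
    if \<xi>: "\<xi> \<in> ell2 X" and N: "\<And>m. m \<ge> N \<Longrightarrow> ?d (s n) (s m) < e" for n N e \<xi>
  proof -
    have "L2_set (\<lambda>x. cmod (s n \<xi> x - T \<xi> x)) F \<le> e * ell2_norm X \<xi>"
      if F: "finite F" "F \<subseteq> X" for F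
    proof (rule tendsto_upperbound)
      show "(\<lambda>m. L2_set (\<lambda>x. cmod (s n \<xi> x - s m \<xi> x)) F) \<longlonglongrightarrow>
          L2_set (\<lambda>x. cmod (s n \<xi> x - T \<xi> x)) F"
        unfolding L2_set_def by (intro tendsto_intros lim \<xi>)
      have "L2_set (\<lambda>x. cmod (s n \<xi> x - s m \<xi> x)) F \<le> e * ell2_norm X \<xi>" if m: "m \<ge> N" for m
      proof -
        have "L2_set (\<lambda>x. cmod (s n \<xi> x - s m \<xi> x)) F \<le> ell2_norm X (\<lambda>x. s n \<xi> x - s m \<xi> x)"
          using \<xi> F by (intro L2_set_le_ell2_norm ell2_diff bounded_opsD(1)[OF b])
        also have "\<dots> \<le> ?d (s n) (s m) * ell2_norm X \<xi>" by (rule dist_op_bound[OF b b \<xi>])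
        also have "\<dots> \<le> e * ell2_norm X \<xi>"
          using N[OF m] by (intro mult_right_mono ell2_norm_nonneg) simp
        finally show ?thesis .
      qed
      then show "\<forall>\<^sub>F m in sequentially. L2_set (\<lambda>x. cmod (s n \<xi> x - s m \<xi> x)) F \<le> e * ell2_norm X \<xi>"
        by (auto simp: eventually_sequentially)
    qed simp
    moreover have "s n \<xi> x - T \<xi> x = 0" if "x \<notin> X" for x
    proof -
      have "s m \<xi> x = 0" for m using bounded_opsD(1)[OF b \<xi>] that by (rule ell2_vanishes)
      then show ?thesis by (simp add: T_def)
    qed
    ultimately show ?thesis using ell2_boundI[of X "\<lambda>x. s n \<xi> x - T \<xi> x"] by blast
  qed
  obtain N1 where N1: "\<And>m n. m \<ge> N1 \<Longrightarrow> n \<ge> N1 \<Longrightarrow> ?d (s m) (s n) < 1" using C[of 1] by auto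
  have near1: "(\<lambda>x. s N1 \<xi> x - T \<xi> x) \<in> ell2 X"
      "ell2_norm X (\<lambda>x. s N1 \<xi> x - T \<xi> x) \<le> 1 * ell2_norm X \<xi>"
    if "\<xi> \<in> ell2 X" for \<xi>
    using near[OF that, of N1 N1 1] N1 by auto
  have T2: "T \<xi> \<in> ell2 X" "ell2_norm X (T \<xi>) \<le> (op_norm X (s N1) + 1) * ell2_norm X \<xi>"
    if \<xi>: "\<xi> \<in> ell2 X" for \<xi>
  proof -
    note m = bounded_opsD(1)[OF b[of N1] \<xi>] ell2_scale[OF near1(1)[OF \<xi>], of "-1"]
    have eq: "T \<xi> = (\<lambda>x. s N1 \<xi> x + (-1) * (s N1 \<xi> x - T \<xi> x))" by simp
    show "T \<xi> \<in> ell2 X" by (subst eq, rule ell2_add(1)[OF m])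
    have "ell2_norm X (T \<xi>) \<le> ell2_norm X (s N1 \<xi>) + ell2_norm X (\<lambda>x. (-1) * (s N1 \<xi> x - T \<xi> x))"
      by (subst eq, rule ell2_add(2)[OF m])
    also have "ell2_norm X (\<lambda>x. (-1) * (s N1 \<xi> x - T \<xi> x)) = ell2_norm X (\<lambda>x. s N1 \<xi> x - T \<xi> x)"
      by (subst ell2_norm_scale) simp
    finally show "ell2_norm X (T \<xi>) \<le> (op_norm X (s N1) + 1) * ell2_norm X \<xi>"
      using near1(2)[OF \<xi>] op_norm_bound[OF b[of N1] \<xi>] by (simp add: distrib_right)
  qed
  have TB: "restrict T (ell2 X) \<in> bounded_ops X"
  proof (rule bounded_opsI[OF T2(1) _ _ T2(2)])
    fix \<xi> \<eta> assume \<xi>: "\<xi> \<in> ell2 X" and \<eta>: "\<eta> \<in> ell2 X"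
    have "T (\<lambda>x. \<xi> x + \<eta> x) x = T \<xi> x + T \<eta> x" for x
      using lim[OF ell2_add(1)[OF \<xi> \<eta>], of x] tendsto_add[OF lim[OF \<xi>, of x] lim[OF \<eta>, of x]]
      by (simp add: bounded_opsD(2)[OF b \<xi> \<eta>] LIMSEQ_unique)
    then show "T (\<lambda>x. \<xi> x + \<eta> x) = (\<lambda>x. T \<xi> x + T \<eta> x)" ..
  next
    fix c \<xi> assume \<xi>: "\<xi> \<in> ell2 X"
    have "T (\<lambda>x. c * \<xi> x) x = c * T \<xi> x" for x
      using lim[OF ell2_scale[OF \<xi>], of c x] tendsto_mult_left[OF lim[OF \<xi>, of x], of c]
      by (simp add: bounded_opsD(3)[OF b \<xi>] LIMSEQ_unique)
    then show "T (\<lambda>x. c * \<xi> x) = (\<lambda>x. c * T \<xi> x)" ..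
  qed
  moreover have "(\<lambda>n. ?d (s n) (restrict T (ell2 X))) \<longlonglongrightarrow> 0"
  proof (rule LIMSEQ_I)
    fix e :: real assume e: "e > 0"
    obtain N where N: "\<And>m n. m \<ge> N \<Longrightarrow> n \<ge> N \<Longrightarrow> ?d (s m) (s n) < e / 2"
      using C[of "e / 2"] e by auto
    have "?d (s n) (restrict T (ell2 X)) \<le> e / 2" if "n \<ge> N" for n
      by (rule dist_op_le) (use near[of _ N n "e / 2"] N that e in auto)
    then show "\<exists>N. \<forall>n\<ge>N. norm (?d (s n) (restrict T (ell2 X)) - 0) < e"
      using e dist_op_nonneg[OF b TB] by (intro exI[of _ N]) (force simp: abs_of_nonneg)
  qed
  ultimately show ?thesis using that by blast
qed

section \<open>Closures of isometric images are completions\<close>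

text \<open>The properties of a complete normed *-algebra that enter the comparison of a closure with
  an abstract completion: its operations are continuous for the metric.\<close>

locale complete_normed_star_algebra =
  fixes B :: "'c normed_star_algebra"
  assumes add_closed: "\<And>S T. S \<in> carr B \<Longrightarrow> T \<in> carr B \<Longrightarrow> aadd B S T \<in> carr B"
    and scale_closed: "\<And>c T. T \<in> carr B \<Longrightarrow> ascale B c T \<in> carr B"
    and mult_closed: "\<And>S T. S \<in> carr B \<Longrightarrow> T \<in> carr B \<Longrightarrow> amult B S T \<in> carr B"
    and star_closed: "\<And>T. T \<in> carr B \<Longrightarrow> astar B T \<in> carr B"
    and dist_nonneg: "\<And>S T. S \<in> carr B \<Longrightarrow> T \<in> carr B \<Longrightarrow> 0 \<le> dist_in B S T"
    and dist_refl: "\<And>T. T \<in> carr B \<Longrightarrow> dist_in B T T = 0"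
    and dist_0_imp_eq: "\<And>S T. S \<in> carr B \<Longrightarrow> T \<in> carr B \<Longrightarrow> dist_in B S T = 0 \<Longrightarrow> S = T"
    and dist_sym: "\<And>S T. S \<in> carr B \<Longrightarrow> T \<in> carr B \<Longrightarrow> dist_in B S T = dist_in B T S"
    and dist_triangle: "\<And>R S T. R \<in> carr B \<Longrightarrow> S \<in> carr B \<Longrightarrow> T \<in> carr B \<Longrightarrow>
        dist_in B R T \<le> dist_in B R S + dist_in B S T"
    and nrm_diff: "\<And>S T. S \<in> carr B \<Longrightarrow> T \<in> carr B \<Longrightarrow> \<bar>nrm B S - nrm B T\<bar> \<le> dist_in B S T"
    and dist_add: "\<And>S S' T T'. S \<in> carr B \<Longrightarrow> S' \<in> carr B \<Longrightarrow> T \<in> carr B \<Longrightarrow> T' \<in> carr B \<Longrightarrow>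
        dist_in B (aadd B S S') (aadd B T T') \<le> dist_in B S T + dist_in B S' T'"
    and dist_scale: "\<And>c S T. S \<in> carr B \<Longrightarrow> T \<in> carr B \<Longrightarrow>
        dist_in B (ascale B c S) (ascale B c T) \<le> cmod c * dist_in B S T"
    and dist_mult: "\<And>S S' T T'. S \<in> carr B \<Longrightarrow> S' \<in> carr B \<Longrightarrow> T \<in> carr B \<Longrightarrow> T' \<in> carr B \<Longrightarrow>
        dist_in B (amult B S S') (amult B T T') \<le> nrm B S * dist_in B S' T' + dist_in B S T * nrm B T'"
    and dist_star: "\<And>S T. S \<in> carr B \<Longrightarrow> T \<in> carr B \<Longrightarrow>
        dist_in B (astar B S) (astar B T) \<le> dist_in B S T"
    and complete: "\<And>s. s \<in> Cauchy_seqs B \<Longrightarrow> \<exists>T\<in>carr B. (\<lambda>n. dist_in B (s n) T) \<longlonglongrightarrow> 0"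
begin

lemma limit_unique:
  assumes c: "\<And>n. s n \<in> carr B" "S \<in> carr B" "T \<in> carr B"
    and "(\<lambda>n. dist_in B (s n) S) \<longlonglongrightarrow> 0" "(\<lambda>n. dist_in B (s n) T) \<longlonglongrightarrow> 0"
  shows "S = T"
proof -
  have "(\<lambda>n. dist_in B (s n) S + dist_in B (s n) T) \<longlonglongrightarrow> 0 + 0"
    by (intro tendsto_add assms)
  moreover have "dist_in B S T \<le> dist_in B (s n) S + dist_in B (s n) T" for n
    using dist_triangle[OF c(2) c(1) c(3), of n] dist_sym[OF c(1,2), of n] by simp
  ultimately have "dist_in B S T \<le> 0" by (auto intro: LIMSEQ_le_const)
  then show ?thesis using dist_nonneg[OF c(2,3)] dist_0_imp_eq[OF c(2,3)] by simp
qed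

lemma nrm_limit:
  assumes "\<And>n. s n \<in> carr B" "T \<in> carr B" "(\<lambda>n. dist_in B (s n) T) \<longlonglongrightarrow> 0"
  shows "(\<lambda>n. nrm B (s n)) \<longlonglongrightarrow> nrm B T"
proof -
  have "(\<lambda>n. nrm B (s n) - nrm B T) \<longlonglongrightarrow> 0"
    by (rule Lim_null_comparison[OF _ assms(3)]) (use nrm_diff assms in auto)
  then show ?thesis by (simp add: LIM_zero_iff)
qed

text \<open>Let \<open>\<pi>\<close> be a *-homomorphism from \<open>A\<close> into \<open>B\<close> that is isometric for the given
  seminorm of \<open>A\<close>. An element \<open>T\<close> of the closure of its image corresponds to the set \<open>\<Phi> T\<close> of
  all sequences \<open>s\<close> in \<open>A\<close> such that \<open>\<pi> \<circ> s\<close> converges to \<open>T\<close>: this set is a full equivalence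
  class of Cauchy sequences, and completeness of \<open>B\<close> shows that every class arises.\<close>

theorem closure_isometric_image_iso_completion:
  fixes A :: "'b normed_star_algebra" and \<pi> :: "'b \<Rightarrow> 'c"
  assumes closed: "\<And>a b. a \<in> carr A \<Longrightarrow> b \<in> carr A \<Longrightarrow> aadd A a b \<in> carr A"
      "\<And>c a. a \<in> carr A \<Longrightarrow> ascale A c a \<in> carr A"
      "\<And>a b. a \<in> carr A \<Longrightarrow> b \<in> carr A \<Longrightarrow> amult A a b \<in> carr A"
      "\<And>a. a \<in> carr A \<Longrightarrow> astar A a \<in> carr A"
    and \<pi>: "\<And>a. a \<in> carr A \<Longrightarrow> \<pi> a \<in> carr B"
    and hom: "\<And>a b. a \<in> carr A \<Longrightarrow> b \<in> carr A \<Longrightarrow> \<pi> (aadd A a b) = aadd B (\<pi> a) (\<pi> b)"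
      "\<And>c a. a \<in> carr A \<Longrightarrow> \<pi> (ascale A c a) = ascale B c (\<pi> a)"
      "\<And>a b. a \<in> carr A \<Longrightarrow> b \<in> carr A \<Longrightarrow> \<pi> (amult A a b) = amult B (\<pi> a) (\<pi> b)"
      "\<And>a. a \<in> carr A \<Longrightarrow> \<pi> (astar A a) = astar B (\<pi> a)"
    and isometric: "\<And>a. a \<in> carr A \<Longrightarrow> nrm A a = nrm B (\<pi> a)"
  defines "D \<equiv> B\<lparr>carr := {T \<in> carr B. \<forall>e>0. \<exists>a\<in>carr A. dist_in B T (\<pi> a) < e}\<rparr>"
  shows "\<exists>\<Phi>. isometric_star_isomorphism D (completion A) \<Phi> \<and>
    (\<forall>a\<in>carr A. \<pi> a \<in> carr D \<and> \<Phi> (\<pi> a) = completion_embedding A a)"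
proof -
  define \<Phi> where "\<Phi> T = {s. (\<forall>n. s n \<in> carr A) \<and> (\<lambda>n. dist_in B (\<pi> (s n)) T) \<longlonglongrightarrow> 0}" for T
  have distA: "dist_in A a b = dist_in B (\<pi> a) (\<pi> b)" if "a \<in> carr A" "b \<in> carr A" for a b
    unfolding dist_in_def using that by (simp add: isometric closed hom)
  have \<Phi>D: "\<And>n. s n \<in> carr A" "(\<lambda>n. dist_in B (\<pi> (s n)) T) \<longlonglongrightarrow> 0" if "s \<in> \<Phi> T" for s T
    using that by (auto simp: \<Phi>_def)
  have Cauchy: "s \<in> Cauchy_seqs A" if s: "s \<in> \<Phi> T" and T: "T \<in> carr B" for s T
  proof -
    have "\<exists>N. \<forall>m\<ge>N. \<forall>n\<ge>N. dist_in A (s m) (s n) < e" if e: "e > 0" for e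
    proof -
      obtain N where N: "\<And>n. n \<ge> N \<Longrightarrow> norm (dist_in B (\<pi> (s n)) T - 0) < e / 2"
        using LIMSEQ_D[OF \<Phi>D(2)[OF s], of "e/2"] e by auto
      have "dist_in A (s m) (s n) < e" if "m \<ge> N" "n \<ge> N" for m n
      proof -
        note p = \<pi>[OF \<Phi>D(1)[OF s]]
        have "dist_in A (s m) (s n) \<le> dist_in B (\<pi> (s m)) T + dist_in B (\<pi> (s n)) T"
          using dist_triangle[OF p T p, of m n] dist_sym[OF p T, of n]
          by (simp add: distA \<Phi>D(1)[OF s])
        then show ?thesis using N[OF that(1)] N[OF that(2)] by simp
      qed
      then show ?thesis by blast
    qed
    then show ?thesis using \<Phi>D(1)[OF s] by (simp add: Cauchy_seqs_def)
  qed
  have cls: "\<Phi> T = Cauchy_rel A `` {s}" if s: "s \<in> \<Phi> T" and T: "T \<in> carr B" for s T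
  proof (intro equalityI subsetI)
    note ps = \<pi>[OF \<Phi>D(1)[OF s]]
    fix t
    { assume t: "t \<in> \<Phi> T"
      note pt = \<pi>[OF \<Phi>D(1)[OF t]]
      have "(\<lambda>n. dist_in A (s n) (t n)) \<longlonglongrightarrow> 0"
      proof (rule Lim_null_comparison)
        show "(\<lambda>n. dist_in B (\<pi> (s n)) T + dist_in B (\<pi> (t n)) T) \<longlonglongrightarrow> 0"
          using tendsto_add[OF \<Phi>D(2)[OF s] \<Phi>D(2)[OF t]] by simp
        show "\<forall>\<^sub>F n in sequentially. norm (dist_in A (s n) (t n))
            \<le> dist_in B (\<pi> (s n)) T + dist_in B (\<pi> (t n)) T"
          using dist_triangle[OF ps T pt] dist_sym[OF pt T] dist_nonneg[OF ps pt]
          by (intro always_eventually) (simp add: distA \<Phi>D(1)[OF s] \<Phi>D(1)[OF t])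
      qed
      then show "t \<in> Cauchy_rel A `` {s}"
        using Cauchy s t T by (auto simp: Cauchy_rel_def)
    next
      assume "t \<in> Cauchy_rel A `` {s}"
      then have t: "\<And>n. t n \<in> carr A" and lim: "(\<lambda>n. dist_in A (s n) (t n)) \<longlonglongrightarrow> 0"
        by (auto simp: Cauchy_rel_def Cauchy_seqs_def)
      note pt = \<pi>[OF t]
      have "(\<lambda>n. dist_in B (\<pi> (t n)) T) \<longlonglongrightarrow> 0"
      proof (rule Lim_null_comparison)
        show "(\<lambda>n. dist_in A (s n) (t n) + dist_in B (\<pi> (s n)) T) \<longlonglongrightarrow> 0"
          using tendsto_add[OF lim \<Phi>D(2)[OF s]] by simp
        show "\<forall>\<^sub>F n in sequentially. norm (dist_in B (\<pi> (t n)) T)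
            \<le> dist_in A (s n) (t n) + dist_in B (\<pi> (s n)) T"
          using dist_triangle[OF pt ps T] dist_sym[OF pt ps] dist_nonneg[OF pt T]
          by (intro always_eventually) (simp add: distA \<Phi>D(1)[OF s] t)
      qed
      then show "t \<in> \<Phi> T" using t by (simp add: \<Phi>_def) }
  qed
  have carrD: "carr D = {T \<in> carr B. \<Phi> T \<noteq> {}}"
  proof (intro equalityI subsetI)
    fix T assume T: "T \<in> carr D"
    then have TB: "T \<in> carr B" by (simp add: D_def)
    have "\<exists>a\<in>carr A. dist_in B T (\<pi> a) < 1 / real (Suc n)" for n
      using T by (simp add: D_def del: of_nat_Suc)
    then obtain s where s: "\<And>n. s n \<in> carr A" "\<And>n. dist_in B T (\<pi> (s n)) < 1 / real (Suc n)"
      by metis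
    have "(\<lambda>n. dist_in B (\<pi> (s n)) T) \<longlonglongrightarrow> 0"
    proof (rule Lim_null_comparison[OF _ LIMSEQ_Suc[OF lim_1_over_n]])
      show "\<forall>\<^sub>F n in sequentially. norm (dist_in B (\<pi> (s n)) T) \<le> 1 / real (Suc n)"
        using s(2) dist_sym[OF TB \<pi>[OF s(1)]] dist_nonneg[OF TB \<pi>[OF s(1)]]
        by (intro always_eventually) (simp add: less_imp_le)
    qed
    then show "T \<in> {T \<in> carr B. \<Phi> T \<noteq> {}}" using s(1) TB by (auto simp: \<Phi>_def)
  next
    fix T assume "T \<in> {T \<in> carr B. \<Phi> T \<noteq> {}}"
    then obtain s where TB: "T \<in> carr B" and s: "s \<in> \<Phi> T" by auto
    have "\<exists>a\<in>carr A. dist_in B T (\<pi> a) < e" if e: "e > 0" for e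
    proof -
      obtain N where "\<And>n. n \<ge> N \<Longrightarrow> norm (dist_in B (\<pi> (s n)) T - 0) < e"
        using LIMSEQ_D[OF \<Phi>D(2)[OF s] e] by auto
      from this[of N] show ?thesis
        using \<Phi>D(1)[OF s, of N] dist_sym[OF TB \<pi>[OF \<Phi>D(1)[OF s, of N]]]
        by (intro bexI[of _ "s N"]) auto
    qed
    then show "T \<in> carr D" using TB by (simp add: D_def)
  qed
  have DB: "T \<in> carr B" if "T \<in> carr D" for T using that by (simp add: carrD)
  have inj: "S = T" if eq: "S \<in> carr D" "T \<in> carr D" "\<Phi> S = \<Phi> T" for S T
  proof -
    obtain s where "s \<in> \<Phi> S" using eq(1) by (auto simp: carrD)
    then have s: "s \<in> \<Phi> S" "s \<in> \<Phi> T" using eq(3) by auto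
    show ?thesis
      by (rule limit_unique[of "\<lambda>n. \<pi> (s n)", OF _ DB DB \<Phi>D(2)[OF s(1)] \<Phi>D(2)[OF s(2)]])
        (use eq \<pi> \<Phi>D(1)[OF s(1)] in auto)
  qed
  have surj: "\<exists>T\<in>carr D. \<Phi> T = Cauchy_rel A `` {s}" if s: "s \<in> Cauchy_seqs A" for s
  proof -
    have sA: "s n \<in> carr A" for n using s by (simp add: Cauchy_seqs_def)
    have "(\<lambda>n. \<pi> (s n)) \<in> Cauchy_seqs B"
      using s by (simp add: Cauchy_seqs_def \<pi> sA distA[OF sA sA])
    from complete[OF this] obtain T where T: "T \<in> carr B" "(\<lambda>n. dist_in B (\<pi> (s n)) T) \<longlonglongrightarrow> 0"
      by blast
    then have "s \<in> \<Phi> T" using sA by (simp add: \<Phi>_def)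
    then show ?thesis using cls T(1) carrD by (intro bexI[of _ T]) auto
  qed
  have bij: "bij_betw \<Phi> (carr D) (carr (completion A))"
    unfolding bij_betw_def
  proof
    show "inj_on \<Phi> (carr D)" using inj by (rule inj_onI)
    show "\<Phi> ` carr D = carr (completion A)"
    proof (intro equalityI subsetI)
      fix C assume "C \<in> \<Phi> ` carr D"
      then obtain T s where T: "C = \<Phi> T" "T \<in> carr B" "s \<in> \<Phi> T" by (auto simp: carrD)
      then show "C \<in> carr (completion A)"
        using cls[OF T(3,2)] Cauchy[OF T(3,2)] by (auto simp: completion_def quotient_def)
    next
      fix C assume "C \<in> carr (completion A)"
      then show "C \<in> \<Phi> ` carr D"
        using surj by (fastforce simp: completion_def quotient_def)
    qed
  qed
  \<comment> \<open>Continuity of the operations of \<open>B\<close> carries approximating sequences to approximating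
    sequences.\<close>
  have add\<Phi>: "(\<lambda>n. aadd A (s n) (t n)) \<in> \<Phi> (aadd B S T)"
    if s: "s \<in> \<Phi> S" and t: "t \<in> \<Phi> T" and ST: "S \<in> carr B" "T \<in> carr B" for s t S T
  proof -
    note c = \<Phi>D(1)[OF s] \<Phi>D(1)[OF t] \<pi>[OF \<Phi>D(1)[OF s]] \<pi>[OF \<Phi>D(1)[OF t]]
    have "(\<lambda>n. dist_in B (\<pi> (aadd A (s n) (t n))) (aadd B S T)) \<longlonglongrightarrow> 0"
    proof (rule Lim_null_comparison)
      show "(\<lambda>n. dist_in B (\<pi> (s n)) S + dist_in B (\<pi> (t n)) T) \<longlonglongrightarrow> 0"
        using tendsto_add[OF \<Phi>D(2)[OF s] \<Phi>D(2)[OF t]] by simp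
    qed (use c ST in \<open>simp add: hom dist_add dist_nonneg add_closed\<close>)
    then show ?thesis using c by (simp add: \<Phi>_def closed)
  qed
  have mult\<Phi>: "(\<lambda>n. amult A (s n) (t n)) \<in> \<Phi> (amult B S T)"
    if s: "s \<in> \<Phi> S" and t: "t \<in> \<Phi> T" and ST: "S \<in> carr B" "T \<in> carr B" for s t S T
  proof -
    note c = \<Phi>D(1)[OF s] \<Phi>D(1)[OF t] \<pi>[OF \<Phi>D(1)[OF s]] \<pi>[OF \<Phi>D(1)[OF t]]
    have "(\<lambda>n. nrm B (\<pi> (s n))) \<longlonglongrightarrow> nrm B S"
      by (rule nrm_limit) (use c ST \<Phi>D(2)[OF s] in auto)
    then have lim: "(\<lambda>n. nrm B (\<pi> (s n)) * dist_in B (\<pi> (t n)) T + dist_in B (\<pi> (s n)) S * nrm B T)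
        \<longlonglongrightarrow> nrm B S * 0 + 0 * nrm B T"
      by (intro tendsto_intros \<Phi>D(2)[OF s] \<Phi>D(2)[OF t])
    have "(\<lambda>n. dist_in B (\<pi> (amult A (s n) (t n))) (amult B S T)) \<longlonglongrightarrow> 0"
      by (rule Lim_null_comparison[OF _ lim[simplified]])
        (use c ST in \<open>simp add: hom dist_mult dist_nonneg mult_closed\<close>)
    then show ?thesis using c by (simp add: \<Phi>_def closed)
  qed
  have scale\<Phi>: "(\<lambda>n. ascale A c (s n)) \<in> \<Phi> (ascale B c T)" 
    if s: "s \<in> \<Phi> T" and T: "T \<in> carr B" for s T c
  proof -
    note c = \<Phi>D(1)[OF s] \<pi>[OF \<Phi>D(1)[OF s]]
    have "(\<lambda>n. dist_in B (\<pi> (ascale A c (s n))) (ascale B c T)) \<longlonglongrightarrow> 0"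
    proof (rule Lim_null_comparison)
      show "(\<lambda>n. cmod c * dist_in B (\<pi> (s n)) T) \<longlonglongrightarrow> 0"
        using tendsto_mult_left[OF \<Phi>D(2)[OF s], of "cmod c"] by simp
    qed (use c T in \<open>simp add: hom dist_scale dist_nonneg scale_closed\<close>)
    then show ?thesis using c by (simp add: \<Phi>_def closed)
  qed
  have star\<Phi>: "(\<lambda>n. astar A (s n)) \<in> \<Phi> (astar B T)" if s: "s \<in> \<Phi> T" and T: "T \<in> carr B" for s T
  proof -
    note c = \<Phi>D(1)[OF s] \<pi>[OF \<Phi>D(1)[OF s]]
    have "(\<lambda>n. dist_in B (\<pi> (astar A (s n))) (astar B T)) \<longlonglongrightarrow> 0"
      by (rule Lim_null_comparison[OF _ \<Phi>D(2)[OF s]])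
       (use c T in \<open>simp add: hom dist_star dist_nonneg star_closed\<close>)
    then show ?thesis using c by (simp add: \<Phi>_def closed)
  qed
  have op2: "op B S T \<in> carr D \<and>
      \<Phi> (op B S T) = (\<Union>s\<in>\<Phi> S. \<Union>t\<in>\<Phi> T. Cauchy_rel A `` {\<lambda>n. op' (s n) (t n)})"
    if ST: "S \<in> carr D" "T \<in> carr D" and cl: "op B S T \<in> carr B"
      and lift: "\<And>s t. s \<in> \<Phi> S \<Longrightarrow> t \<in> \<Phi> T \<Longrightarrow> (\<lambda>n. op' (s n) (t n)) \<in> \<Phi> (op B S T)"
    for op S T and op' :: "'b \<Rightarrow> 'b \<Rightarrow> 'b"
  proof -
    obtain s t where st: "s \<in> \<Phi> S" "t \<in> \<Phi> T" using ST by (auto simp: carrD)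
    have "(\<Union>s\<in>\<Phi> S. \<Union>t\<in>\<Phi> T. Cauchy_rel A `` {\<lambda>n. op' (s n) (t n)}) 
        = (\<Union>s\<in>\<Phi> S. \<Union>t\<in>\<Phi> T. \<Phi> (op B S T))"
      by (intro SUP_cong refl cls[symmetric] lift cl)
    then show ?thesis using st lift[OF st] cl by (auto simp: carrD)
  qed
  have op1: "op B T \<in> carr D \<and> \<Phi> (op B T) = (\<Union>s\<in>\<Phi> T. Cauchy_rel A `` {\<lambda>n. op' (s n)})"
    if T: "T \<in> carr D" and cl: "op B T \<in> carr B"
      and lift: "\<And>s. s \<in> \<Phi> T \<Longrightarrow> (\<lambda>n. op' (s n)) \<in> \<Phi> (op B T)"
    for op T and op' :: "'b \<Rightarrow> 'b"
  proof -
    obtain s where s: "s \<in> \<Phi> T" using T by (auto simp: carrD)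
    have "(\<Union>s\<in>\<Phi> T. Cauchy_rel A `` {\<lambda>n. op' (s n)}) = (\<Union>s\<in>\<Phi> T. \<Phi> (op B T))"
      by (intro SUP_cong refl cls[symmetric] lift cl)
    then show ?thesis using s lift[OF s] cl by (auto simp: carrD)
  qed
  have norm: "nrm (completion A) (\<Phi> T) = nrm B T" if T: "T \<in> carr D" for T
  proof -
    obtain s where s: "s \<in> \<Phi> T" using T by (auto simp: carrD)
    have lim: "(\<lambda>n. nrm A (t n)) \<longlonglongrightarrow> nrm B T" if t: "t \<in> \<Phi> T" for t
      using nrm_limit[of "\<lambda>n. \<pi> (t n)", OF \<pi>[OF \<Phi>D(1)[OF t]] DB[OF T] \<Phi>D(2)[OF t]]
      by (simp add: isometric \<Phi>D(1)[OF t])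
    have "(THE c. \<forall>s\<in>\<Phi> T. (\<lambda>n. nrm A (s n)) \<longlonglongrightarrow> c) = nrm B T"
      by (rule the_equality) (use lim s LIMSEQ_unique in blast)+
    then show ?thesis by (simp add: completion_def)
  qed
  have D_simps: "aadd D = aadd B" "ascale D = ascale B" "amult D = amult B" "astar D = astar B"
      "nrm D = nrm B" by (simp_all add: D_def)
  have "isometric_star_isomorphism D (completion A) \<Phi>"
    unfolding isometric_star_isomorphism_def D_simps
  proof (intro conjI ballI allI bij)
    fix S T assume ST: "S \<in> carr D" "T \<in> carr D"
    note B = DB[OF ST(1)] DB[OF ST(2)]
    note a = op2[of S T aadd "aadd A", OF ST add_closed[OF B] add\<Phi>[OF _ _ B]]
    note m = op2[of S T amult "amult A", OF ST mult_closed[OF B] mult\<Phi>[OF _ _ B]]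
    show "aadd B S T \<in> carr D" "amult B S T \<in> carr D" using a m by auto
    show "\<Phi> (aadd B S T) = aadd (completion A) (\<Phi> S) (\<Phi> T)"
      using a by (simp add: completion_def)
    show "\<Phi> (amult B S T) = amult (completion A) (\<Phi> S) (\<Phi> T)"
      using m by (simp add: completion_def)
  next
    fix c T assume T: "T \<in> carr D"
    note s = op1[of T "\<lambda>B. ascale B c" "ascale A c", OF T scale_closed[OF DB[OF T]] scale\<Phi>[OF _ DB[OF T]]]
    show "ascale B c T \<in> carr D" using s by auto
    show "\<Phi> (ascale B c T) = ascale (completion A) c (\<Phi> T)"
      using s by (simp add: completion_def)
  next
    fix T assume T: "T \<in> carr D"
    note s = op1[of T astar "astar A", OF T star_closed[OF DB[OF T]] star\<Phi>[OF _ DB[OF T]]]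
    show "astar B T \<in> carr D" using s by auto
    show "\<Phi> (astar B T) = astar (completion A) (\<Phi> T)" using s by (simp add: completion_def)
    show "nrm (completion A) (\<Phi> T) = nrm B T" by (rule norm[OF T])
  qed
  moreover have "\<pi> a \<in> carr D \<and> \<Phi> (\<pi> a) = completion_embedding A a" if a: "a \<in> carr A" for a
  proof -
    have s: "(\<lambda>n. a) \<in> \<Phi> (\<pi> a)" using a by (simp add: \<Phi>_def dist_refl \<pi>)
    show ?thesis
      using cls[OF s \<pi>[OF a]] s \<pi>[OF a] by (auto simp: carrD completion_embedding_def)
  qed
  ultimately show ?thesis by blast
qed

end

lemma complete_normed_star_algebra_op_algebra: "complete_normed_star_algebra (op_algebra X)"
proof
  let ?B = "op_algebra X" let ?d = "dist_in (op_algebra X)"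
  fix R S S' T T' :: "'a ell2_op" and c :: complex
  assume R: "R \<in> carr ?B" and S: "S \<in> carr ?B" and T: "T \<in> carr ?B"
  note BD = R[simplified] S[simplified] T[simplified]
  have flip: "ell2_norm X (\<lambda>x. f x - g x) = ell2_norm X (\<lambda>x. g x - f x)" for f g
    by (simp add: ell2_norm_def norm_minus_commute)
  show "aadd ?B S T \<in> carr ?B" using BD by (simp add: bounded_ops_add)
  show "ascale ?B c T \<in> carr ?B" using BD by (simp add: bounded_ops_scale)
  show "amult ?B S T \<in> carr ?B" using BD by (simp add: bounded_ops_compose)
  show "astar ?B T \<in> carr ?B" using BD by (simp add: adjoint_op)
  show nn: "0 \<le> ?d S T" using BD by (simp add: dist_op_nonneg)
  have "?d T T \<le> 0" by (rule dist_op_le) (simp_all add: ell2_norm_def)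
  then show "?d T T = 0" using dist_op_nonneg[OF BD(3) BD(3)] by simp
  show "S = T" if "?d S T = 0"
  proof (rule bounded_op_ext_on_delta[OF BD(2,3)])
    fix z assume "z \<in> X"
    then have z: "delta z \<in> ell2 X" by (rule ell2_delta)
    note m = bounded_opsD(1)[OF BD(2) z] bounded_opsD(1)[OF BD(3) z]
    have "ell2_norm X (\<lambda>x. S (delta z) x - T (delta z) x) = 0"
      using dist_op_bound[OF BD(2,3) z] that by (simp add: ell2_norm_nonneg order_antisym)
    then have "(\<lambda>x. S (delta z) x - T (delta z) x) = (\<lambda>x. 0)"
      by (simp only: ell2_norm_zero_iff[OF ell2_diff[OF m]])
    then show "S (delta z) = T (delta z)" by (simp add: fun_eq_iff)
  qed
  have "?d S T \<le> ?d T S" if "S \<in> bounded_ops X" "T \<in> bounded_ops X" for S T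
    by (rule dist_op_le)
      (use dist_op_bound[OF that(2,1)] dist_op_nonneg[OF that(2,1)] in \<open>simp_all add: flip[of "S _"]\<close>)
  then show "?d S T = ?d T S" using BD by (simp add: order_antisym)
  show "?d R T \<le> ?d R S + ?d S T"
  proof (rule dist_op_le)
    fix \<xi> assume \<xi>: "\<xi> \<in> ell2 X"
    note m = bounded_opsD(1)[OF BD(1) \<xi>] bounded_opsD(1)[OF BD(2) \<xi>] bounded_opsD(1)[OF BD(3) \<xi>]
    have "ell2_norm X (\<lambda>x. R \<xi> x - T \<xi> x) \<le>
        ell2_norm X (\<lambda>x. R \<xi> x - S \<xi> x) + ell2_norm X (\<lambda>x. S \<xi> x - T \<xi> x)"
      using ell2_add(2)[OF ell2_diff[OF m(1,2)] ell2_diff[OF m(2,3)]] by simp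
    then show "ell2_norm X (\<lambda>x. R \<xi> x - T \<xi> x) \<le> (?d R S + ?d S T) * ell2_norm X \<xi>"
      using dist_op_bound[OF BD(1,2) \<xi>] dist_op_bound[OF BD(2,3) \<xi>] by (simp add: distrib_right)
  qed (simp add: BD dist_op_nonneg)
  have "op_norm X S - op_norm X T \<le> ?d S T" if S: "S \<in> bounded_ops X" and T: "T \<in> bounded_ops X" for S T
  proof -
    have "op_norm X S \<le> op_norm X T + ?d S T"
    proof (rule op_norm_le)
      fix \<xi> assume \<xi>: "\<xi> \<in> ell2 X"
      note m = bounded_opsD(1)[OF S \<xi>] bounded_opsD(1)[OF T \<xi>]
      have "ell2_norm X (S \<xi>) \<le> ell2_norm X (T \<xi>) + ell2_norm X (\<lambda>x. S \<xi> x - T \<xi> x)"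
        using ell2_add(2)[OF m(2) ell2_diff[OF m]] by simp
      then show "ell2_norm X (S \<xi>) \<le> (op_norm X T + ?d S T) * ell2_norm X \<xi>"
        using dist_op_bound[OF S T \<xi>] op_norm_bound[OF T \<xi>] by (simp add: distrib_right)
    qed (simp add: op_norm_nonneg dist_op_nonneg S T)
    then show ?thesis by simp
  qed
  from this[OF BD(2,3)] this[OF BD(3,2)] show "\<bar>nrm ?B S - nrm ?B T\<bar> \<le> ?d S T"
    using \<open>?d S T = ?d T S\<close> by (simp add: abs_le_iff)
  show "?d (ascale ?B c S) (ascale ?B c T) \<le> cmod c * ?d S T"
  proof (rule dist_op_le)
    fix \<xi> assume \<xi>: "\<xi> \<in> ell2 X"
    have "ell2_norm X (\<lambda>x. c * S \<xi> x - c * T \<xi> x) = cmod c * ell2_norm X (\<lambda>x. S \<xi> x - T \<xi> x)"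
      using ell2_norm_scale[of X c "\<lambda>x. S \<xi> x - T \<xi> x"] by (simp add: right_diff_distrib)
    then show "ell2_norm X (\<lambda>x. ascale ?B c S \<xi> x - ascale ?B c T \<xi> x) \<le> cmod c * ?d S T * ell2_norm X \<xi>"
      using \<xi> dist_op_bound[OF BD(2,3) \<xi>] by (simp add: mult.assoc mult_left_mono)
  qed (simp add: dist_op_nonneg BD)
  show "?d (astar ?B S) (astar ?B T) \<le> ?d S T" using BD by (simp add: dist_adjoint_le)
  assume S': "S' \<in> carr ?B" and T': "T' \<in> carr ?B"
  note BD' = S'[simplified] T'[simplified]
  show "?d (aadd ?B S S') (aadd ?B T T') \<le> ?d S T + ?d S' T'"
  proof (rule dist_op_le)
    fix \<xi> assume \<xi>: "\<xi> \<in> ell2 X"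
    note m = ell2_diff[OF bounded_opsD(1)[OF BD(2) \<xi>] bounded_opsD(1)[OF BD(3) \<xi>]]
     ell2_diff[OF bounded_opsD(1)[OF BD'(1) \<xi>] bounded_opsD(1)[OF BD'(2) \<xi>]]
    show "ell2_norm X (\<lambda>x. aadd ?B S S' \<xi> x - aadd ?B T T' \<xi> x) \<le> (?d S T + ?d S' T') * ell2_norm X \<xi>"
      using ell2_add(2)[OF m] dist_op_bound[OF BD(2,3) \<xi>] dist_op_bound[OF BD' \<xi>] \<xi>
      by (simp add: distrib_right add_diff_add)
  qed (simp add: dist_op_nonneg BD BD')
  show "?d (amult ?B S S') (amult ?B T T') \<le> nrm ?B S * ?d S' T' + ?d S T * nrm ?B T'"
  proof (rule dist_op_le)
    fix \<xi> assume \<xi>: "\<xi> \<in> ell2 X"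
    note S'\<xi> = bounded_opsD(1)[OF BD'(1) \<xi>] and T'\<xi> = bounded_opsD(1)[OF BD'(2) \<xi>]
    let ?\<eta> = "\<lambda>x. S' \<xi> x - T' \<xi> x"
    have \<eta>: "?\<eta> \<in> ell2 X" by (rule ell2_diff[OF S'\<xi> T'\<xi>])
    have eq: "S (S' \<xi>) = (\<lambda>x. S ?\<eta> x + S (T' \<xi>) x)"
      using bounded_opsD(2)[OF BD(2) \<eta> T'\<xi>] by simp
    have "ell2_norm X (\<lambda>x. S (S' \<xi>) x - T (T' \<xi>) x)
        = ell2_norm X (\<lambda>x. S ?\<eta> x + (S (T' \<xi>) x - T (T' \<xi>) x))"
      by (subst eq) (simp add: add_diff_eq)
    also have "\<dots> \<le> ell2_norm X (S ?\<eta>) + ell2_norm X (\<lambda>x. S (T' \<xi>) x - T (T' \<xi>) x)"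
      by (intro ell2_add(2) ell2_diff bounded_opsD(1)[OF BD(2)] bounded_opsD(1)[OF BD(3)] T'\<xi> \<eta>)
    also have "\<dots> \<le> op_norm X S * (?d S' T' * ell2_norm X \<xi>) + ?d S T * (op_norm X T' * ell2_norm X \<xi>)"
    proof (rule add_mono)
      show "ell2_norm X (S ?\<eta>) \<le> op_norm X S * (?d S' T' * ell2_norm X \<xi>)"
        using op_norm_bound[OF BD(2) \<eta>] 
          mult_left_mono[OF dist_op_bound[OF BD' \<xi>] op_norm_nonneg[OF BD(2)]] by simp
      show "ell2_norm X (\<lambda>x. S (T' \<xi>) x - T (T' \<xi>) x) \<le> ?d S T * (op_norm X T' * ell2_norm X \<xi>)"
        using dist_op_bound[OF BD(2,3) T'\<xi>]
          mult_left_mono[OF op_norm_bound[OF BD'(2) \<xi>] dist_op_nonneg[OF BD(2,3)]] by simp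
    qed
    finally show "ell2_norm X (\<lambda>x. amult ?B S S' \<xi> x - amult ?B T T' \<xi> x)
        \<le> (nrm ?B S * ?d S' T' + ?d S T * nrm ?B T') * ell2_norm X \<xi>"
      using \<xi> by (simp add: compose_def distrib_right mult.assoc)
  qed (simp add: dist_op_nonneg op_norm_nonneg BD BD')
next
  fix s assume "s \<in> Cauchy_seqs (op_algebra X)"
  then show "\<exists>T\<in>carr (op_algebra X). (\<lambda>n. dist_in (op_algebra X) (s n) T) \<longlonglongrightarrow> 0"
    by (metis bounded_ops_complete op_algebra_simps(1))
qed

section \<open>Continuous functions with compact support\<close>

lemma local_homeomorphism_continuous_map:
  assumes "local_homeomorphism X Y f"
  shows "continuous_map X Y f"
  unfolding continuous_map
proof (intro conjI allI impI)
  show "f ` topspace X \<subseteq> topspace Y"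
    using assms openin_subset unfolding local_homeomorphism_def by blast
  fix W assume W: "openin Y W"
  show "openin X {x \<in> topspace X. f x \<in> W}"
  proof (subst openin_subopen, intro ballI)
    fix x assume x: "x \<in> {x \<in> topspace X. f x \<in> W}"
    then obtain U where U: "openin X U" "x \<in> U"
      "homeomorphic_map (subtopology X U) (subtopology Y (f ` U)) f"
      using assms unfolding local_homeomorphism_def by blast
    have "continuous_map (subtopology X U) Y f"
      using U(3) homeomorphic_imp_continuous_map continuous_map_into_fulltopology by blast
    from openin_continuous_map_preimage[OF this W]
    have "openin (subtopology X U) {y \<in> topspace X \<inter> U. f y \<in> W}" by simp
    then have "openin X {y \<in> topspace X \<inter> U. f y \<in> W}" using U(1) openin_trans_full by blast
    then show "\<exists>T. openin X T \<and> x \<in> T \<and> T \<subseteq> {x \<in> topspace X. f x \<in> W}"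
      using x U(2) by (intro exI[of _ "{y \<in> topspace X \<inter> U. f y \<in> W}"]) auto
  qed
qed

lemma local_homeomorphism_open_map:
  assumes "local_homeomorphism X Y f"
  shows "open_map X Y f"
  unfolding open_map_def
proof (intro allI impI)
  fix S assume S: "openin X S"
  show "openin Y (f ` S)"
  proof (subst openin_subopen, intro ballI)
    fix y assume "y \<in> f ` S"
    then obtain x where x: "x \<in> S" "y = f x" by auto
    then have "x \<in> topspace X" using S openin_subset by blast
    then obtain U where U: "openin X U" "x \<in> U" "openin Y (f ` U)"
      "homeomorphic_map (subtopology X U) (subtopology Y (f ` U)) f"
      using assms unfolding local_homeomorphism_def by blast
    have "openin (subtopology X U) (S \<inter> U)" using S by (simp add: openin_subtopology_Int)
    then have "openin (subtopology Y (f ` U)) (f ` (S \<inter> U))"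
      using homeomorphic_imp_open_map[OF U(4)] by (simp add: open_map_def)
    then have "openin Y (f ` (S \<inter> U))" using U(3) openin_trans_full by blast
    then show "\<exists>T. openin Y T \<and> y \<in> T \<and> T \<subseteq> f ` S"
      using x U(2) by (intro exI[of _ "f ` (S \<inter> U)"]) auto
  qed
qed

lemma local_homeomorphism_inj_nhd:
  assumes "local_homeomorphism X Y f" "x \<in> topspace X"
  obtains U where "openin X U" "x \<in> U" "inj_on f U"
proof -
  obtain U where U: "openin X U" "x \<in> U" "homeomorphic_map (subtopology X U) (subtopology Y (f ` U)) f"
    using assms unfolding local_homeomorphism_def by blast
  have "inj_on f (topspace X \<inter> U)"
    using homeomorphic_imp_injective_map[OF U(3)] by simp
  then show ?thesis using that U openin_subset by (metis inf.absorb_iff2)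
qed

lemma local_homeomorphism_restrict:
  assumes f: "local_homeomorphism X Y f" and U: "openin X U" "inj_on f U"
  shows "homeomorphic_map (subtopology X U) (subtopology Y (f ` U)) f"
proof (rule bijective_open_imp_homeomorphic_map)
  have UX: "topspace X \<inter> U = U" using U(1) openin_subset by blast
  note c = local_homeomorphism_continuous_map[OF f] and o = local_homeomorphism_open_map[OF f]
  have fU: "openin Y (f ` U)" using o U(1) by (simp add: open_map_def)
  then have fUY: "topspace Y \<inter> f ` U = f ` U" using openin_subset by blast
  show "continuous_map (subtopology X U) (subtopology Y (f ` U)) f"
    using c by (auto simp: continuous_map_in_subtopology continuous_map_from_subtopology)
  show "open_map (subtopology X U) (subtopology Y (f ` U)) f"
    using o U(1) fU unfolding open_map_def by (auto simp: openin_open_subtopology)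
  show "f ` topspace (subtopology X U) = topspace (subtopology Y (f ` U))" by (simp add: UX fUY)
  show "inj_on f (topspace (subtopology X U))" using U(2) by (simp add: UX)
qed

lemma continuous_map_mult_complex:
  fixes f g :: "'a \<Rightarrow> complex"
  assumes "continuous_map X euclidean f" "continuous_map X euclidean g"
  shows "continuous_map X euclidean (\<lambda>x. f x * g x)"
  using assms by (simp add: continuous_map_atin tendsto_mult)

text \<open>Any compact subset of \<open>V\<close> that carries the function may replace the closure of the set where
  it is nonzero; such sets transport along maps more easily than closures do.\<close>

lemma Cc_iff:
  assumes V: "openin (gtop G) V" and H: "Hausdorff_space (subtopology (gtop G) V)"
  shows "f \<in> Cc G V \<longleftrightarrow> continuous_map (subtopology (gtop G) V) euclidean f \<and>
    (\<exists>K. compactin (gtop G) K \<and> K \<subseteq> V \<and> (\<forall>x. x \<notin> K \<longrightarrow> f x = 0))"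
    (is "?L \<longleftrightarrow> ?R")
proof
  let ?V = "subtopology (gtop G) V"
  have top: "topspace ?V = V" using openin_subset[OF V] by auto
  { assume ?L
    then have "continuous_map ?V euclidean f" "\<And>x. x \<notin> V \<Longrightarrow> f x = 0"
      and c: "compactin ?V (?V closure_of {x \<in> V. f x \<noteq> 0})"
      by (auto simp: Cc_def)
    moreover have "{x \<in> V. f x \<noteq> 0} \<subseteq> ?V closure_of {x \<in> V. f x \<noteq> 0}"
      by (rule closure_of_subset) (unfold top, blast)
    ultimately show ?R
      by (intro conjI exI[of _ "?V closure_of {x \<in> V. f x \<noteq> 0}"]) (auto simp: compactin_subtopology)
  next
    assume R: ?R
    then obtain K where K: "compactin (gtop G) K" "K \<subseteq> V" "\<And>x. x \<notin> K \<Longrightarrow> f x = 0" by blast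
    have c: "compactin ?V K" using K by (simp add: compactin_subtopology)
    have "?V closure_of {x \<in> V. f x \<noteq> 0} \<subseteq> K"
      by (rule closure_of_minimal[OF _ compactin_imp_closedin[OF H c]]) (use K in auto)
    then have "compactin ?V (?V closure_of {x \<in> V. f x \<noteq> 0})"
      using c closed_compactin closedin_closure_of by blast
    then show ?L using R K by (auto simp: Cc_def) }
qed

text \<open>A compact set is closed in a Hausdorff open set that contains it, so extension by zero
  from one open set to a larger Hausdorff one preserves continuity.\<close>

lemma continuous_map_extend_by_zero:
  fixes h :: "'a \<Rightarrow> 'b::{zero, topological_space}"
  assumes V: "openin X V" "Hausdorff_space (subtopology X V)" and B: "openin X B" "B \<subseteq> V"
    and K: "compactin X K" "K \<subseteq> B" "\<And>x. x \<notin> K \<Longrightarrow> h x = 0"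
    and h: "continuous_map (subtopology X B) euclidean h"
  shows "continuous_map (subtopology X V) euclidean h"
  unfolding continuous_map
proof (intro conjI allI impI)
  fix W :: "'b set" assume W: "openin euclidean W"
  have top: "topspace (subtopology X V) = V" "topspace (subtopology X B) = B"
    using openin_subset[OF V(1)] openin_subset[OF B(1)] by auto
  have "compactin (subtopology X V) K" using K B by (auto simp: compactin_subtopology)
  then have "openin (subtopology X V) (V - K)"
    using compactin_imp_closedin[OF V(2)] top by (metis openin_diff openin_topspace)
  then have o1: "openin X (V - K)" using V(1) openin_trans_full by blast
  have "openin (subtopology X B) {y \<in> B. h y \<in> W}"
    using openin_continuous_map_preimage[OF h W] by (simp only: top)
  then have o2: "openin X {y \<in> B. h y \<in> W}" using B(1) openin_trans_full by blast
  have "{y \<in> V. h y \<in> W} = {y \<in> B. h y \<in> W} \<union> (if 0 \<in> W then V - K else {})"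
  proof (cases "0 \<in> W")
    case True
    then show ?thesis using K(2,3) B(2) by force
  next
    case False
    then have "y \<in> K" if "h y \<in> W" for y using that K(3)[of y] by metis
    then show ?thesis using K(2) B(2) False by auto
  qed
  then have "openin X {y \<in> V. h y \<in> W}" using o1 o2 by (auto intro: openin_Un)
  then show "openin (subtopology X V) {x \<in> topspace (subtopology X V). h x \<in> W}"
    using V(1) unfolding top by (auto simp: openin_open_subtopology)
qed auto

section \<open>Groupoid identities and open bisections\<close>

definition bisection :: "'a topological_groupoid \<Rightarrow> 'a set \<Rightarrow> bool" where
  "bisection G B \<longleftrightarrow> openin (gtop G) B \<and> inj_on (src G) B \<and> inj_on (rng G) B"

locale etale =
  fixes G :: "'a topological_groupoid" (structure)
  assumes etale: "etale_groupoid G"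
begin

abbreviation gprod (infixl "\<cdot>" 70) where "x \<cdot> y \<equiv> gmult G x y"
abbreviation iv where "iv x \<equiv> ginv G x"
abbreviation d where "d x \<equiv> src G x"
abbreviation r where "r x \<equiv> rng G x"
abbreviation \<G> where "\<G> \<equiv> arrows G"

lemma groupoid: "groupoid G"
  using etale by (simp add: etale_groupoid_def is_topological_groupoid_def)

lemma arrow_simps [simp]:
  assumes "x \<in> \<G>"
  shows "d x \<in> \<G>" "r x \<in> \<G>" "iv x \<in> \<G>" "d (d x) = d x" "r (d x) = d x" "d (r x) = r x" "r (r x) = r x"
    "x \<cdot> d x = x" "r x \<cdot> x = x" "d (iv x) = r x" "r (iv x) = d x"
    "iv x \<cdot> x = d x" "x \<cdot> iv x = r x"
  using groupoid assms unfolding groupoid_def by blast+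

lemma prod_simps [simp]:
  assumes "x \<in> \<G>" "y \<in> \<G>" "d x = r y"
  shows "x \<cdot> y \<in> \<G>" "d (x \<cdot> y) = d y" "r (x \<cdot> y) = r x"
proof -
  have "(x, y) \<in> composable G" using assms by (simp add: composable_def)
  then show "x \<cdot> y \<in> \<G>" "d (x \<cdot> y) = d y" "r (x \<cdot> y) = r x"
    using bspec[OF conjunct1[OF conjunct2[OF groupoid[unfolded groupoid_def]]], of "(x, y)"] by simp_all
qed

lemma prod_assoc:
  assumes "x \<in> \<G>" "y \<in> \<G>" "z \<in> \<G>" "d x = r y" "d y = r z"
  shows "x \<cdot> y \<cdot> z = x \<cdot> (y \<cdot> z)"
proof -
  have "(x, y) \<in> composable G" "(y, z) \<in> composable G" using assms by (auto simp: composable_def)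
  then show ?thesis using conjunct2[OF conjunct2[OF groupoid[unfolded groupoid_def]]] by simp
qed

lemma cancel_simps [simp]:
  assumes "x \<in> \<G>" "y \<in> \<G>"
  shows "d x = r y \<Longrightarrow> iv x \<cdot> (x \<cdot> y) = y"
    and "r x = r y \<Longrightarrow> x \<cdot> (iv x \<cdot> y) = y"
    and "d x = r y \<Longrightarrow> x \<cdot> y \<cdot> iv y = x"
    and "d x = d y \<Longrightarrow> x \<cdot> iv y \<cdot> y = x"
proof -
  note A = arrow_simps[OF assms(1)] arrow_simps[OF assms(2)]
  show "iv x \<cdot> (x \<cdot> y) = y" if "d x = r y"
    using prod_assoc[OF A(3) assms A(10) that] A(12,22) that by simp
  show "x \<cdot> (iv x \<cdot> y) = y" if "r x = r y"
    using prod_assoc[OF assms(1) A(3) assms(2) A(11)[symmetric]] A(10,13,22) that by simp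
  show "x \<cdot> y \<cdot> iv y = x" if "d x = r y"
    using prod_assoc[OF assms A(16) that A(24)[symmetric]] A(26) A(8) that by simp
  show "x \<cdot> iv y \<cdot> y = x" if "d x = d y"
    using prod_assoc[OF assms(1) A(16) assms(2)] A(24,23,25,8) that by simp
qed

lemma iv_iv [simp]: "x \<in> \<G> \<Longrightarrow> iv (iv x) = x"
  using cancel_simps(1)[of "iv x" x] arrow_simps(8)[of "iv (iv x)"] by simp

lemma iv_unique:
  assumes "a \<in> \<G>" "b \<in> \<G>" "d b = r a" "b \<cdot> a = d a"
  shows "b = iv a"
  using assms cancel_simps(3)[of b a] arrow_simps(9)[of "iv a"] by simp

lemma iv_prod: "x \<in> \<G> \<Longrightarrow> y \<in> \<G> \<Longrightarrow> d x = r y \<Longrightarrow> iv (x \<cdot> y) = iv y \<cdot> iv x"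
  by (rule iv_unique[symmetric]) (simp_all add: prod_assoc)

lemma local_homeo: "local_homeomorphism (gtop G) (unit_space G) (src G)"
    "local_homeomorphism (gtop G) (unit_space G) (rng G)"
  using etale by (auto simp: etale_groupoid_def)

lemma unit_space: "locally_compact_space (unit_space G)" "Hausdorff_space (unit_space G)"
  using etale by (auto simp: etale_groupoid_def)

lemma continuous_iv: "continuous_map (gtop G) (gtop G) (ginv G)"
  using etale by (simp add: etale_groupoid_def is_topological_groupoid_def)

lemma continuous_prod: "continuous_map (subtopology (prod_topology (gtop G) (gtop G)) (composable G))
    (gtop G) (\<lambda>(x, y). x \<cdot> y)"
  using etale by (simp add: etale_groupoid_def is_topological_groupoid_def)

lemma bisection_nhd:
  assumes "openin (gtop G) V" "x \<in> V"
  obtains B where "bisection G B" "x \<in> B" "B \<subseteq> V"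
proof -
  have x: "x \<in> \<G>" using assms openin_subset by blast
  obtain U1 where U1: "openin (gtop G) U1" "x \<in> U1" "inj_on (src G) U1"
    using local_homeomorphism_inj_nhd[OF local_homeo(1) x] .
  obtain U2 where U2: "openin (gtop G) U2" "x \<in> U2" "inj_on (rng G) U2"
    using local_homeomorphism_inj_nhd[OF local_homeo(2) x] .
  show ?thesis
  proof (rule that)
    show "bisection G (U1 \<inter> U2 \<inter> V)"
      unfolding bisection_def using U1 U2 assms by (auto intro: inj_on_subset)
  qed (use assms U1 U2 in auto)
qed

lemma bisectionD:
  assumes "bisection G B"
  shows "openin (gtop G) B" "B \<subseteq> \<G>" "inj_on (src G) B" "inj_on (rng G) B"
    "Hausdorff_space (subtopology (gtop G) B)"
    "topspace (subtopology (gtop G) B) = B"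
    "locally_compact_space (subtopology (gtop G) B)"
proof -
  show B: "openin (gtop G) B" "inj_on (src G) B" "inj_on (rng G) B"
    using assms by (auto simp: bisection_def)
  show BG: "B \<subseteq> \<G>" using B openin_subset by blast
  then show top: "topspace (subtopology (gtop G) B) = B" by auto
  note hom = local_homeomorphism_restrict[OF local_homeo(1) B(1,2)]
  show "Hausdorff_space (subtopology (gtop G) B)"
    by (rule Hausdorff_space_injective_preimage[OF unit_space(2), of _ "src G"])
      (use B top continuous_map_from_subtopology[OF local_homeomorphism_continuous_map[OF local_homeo(1)]]
        in auto)
  have "openin (unit_space G) (src G ` B)"
    using local_homeomorphism_open_map[OF local_homeo(1)] B(1) by (simp add: open_map_def)
  then have "locally_compact_space (subtopology (unit_space G) (src G ` B))"
    using unit_space locally_compact_space_open_subset by blast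
  then show "locally_compact_space (subtopology (gtop G) B)"
    using homeomorphic_locally_compact_space homeomorphic_map_imp_homeomorphic_space[OF hom] by blast
qed

text \<open>An open bisection is homeomorphic to an open subset of the unit space, hence locally compact
  Hausdorff and completely regular. The value 2 leaves a neighbourhood of \<open>x\<close> on which \<open>h\<close>
  exceeds 1.\<close>

lemma bump_function:
  assumes B: "bisection G B" and x: "x \<in> B"
  obtains h :: "'a \<Rightarrow> real" and K where "\<And>y. 0 \<le> h y" "h x = 2"
    "continuous_map (subtopology (gtop G) B) euclidean h"
    "compactin (gtop G) K" "K \<subseteq> B" "\<And>y. y \<notin> K \<Longrightarrow> h y = 0"
proof -
  let ?B = "subtopology (gtop G) B"
  note BD = bisectionD[OF B]
  obtain U K where UK: "openin ?B U" "compactin ?B K" "x \<in> U" "U \<subseteq> K"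
    using bspec[OF BD(7)[unfolded locally_compact_space_def], of x] x BD(6) by auto
  have "completely_regular_space ?B"
    using locally_compact_regular_imp_completely_regular_space BD by blast
  moreover have "closedin ?B (B - U)" "x \<in> topspace ?B - (B - U)"
    using UK x BD(6) closedin_diff[OF closedin_topspace UK(1)] by simp_all
  ultimately obtain f :: "'a \<Rightarrow> real" where f: "continuous_map ?B (top_of_set {0..1}) f"
    "f x = 0" "f ` (B - U) \<subseteq> {1}"
    unfolding completely_regular_space_def by blast
  then have f01: "f y \<in> {0..1}" if "y \<in> B" for y
    using that BD(6) by (auto simp: continuous_map_in_subtopology)
  define h where "h y = (if y \<in> B then 2 * (1 - f y) else 0)" for y
  have "continuous_map ?B euclidean (\<lambda>y. 2 * (1 - f y))"
    using f(1) by (intro continuous_map_real_mult continuous_map_diff)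
      (auto simp: continuous_map_in_subtopology)
  then have "continuous_map ?B euclidean h"
    by (rule continuous_map_eq) (simp add: h_def)
  moreover have "h y = 0" if "y \<notin> K" for y
    using that UK(4) f(3) by (force simp: h_def)
  ultimately show ?thesis
    using that[of h K] f(2) x f01 UK(2) by (auto simp: h_def compactin_subtopology)
qed

section \<open>Reduction to open bisections\<close>

lemma Cc_bisection_iff:
  assumes "bisection G B"
  shows "f \<in> Cc G B \<longleftrightarrow> continuous_map (subtopology (gtop G) B) euclidean f \<and>
    (\<exists>K. compactin (gtop G) K \<and> K \<subseteq> B \<and> (\<forall>x. x \<notin> K \<longrightarrow> f x = 0))"
  using Cc_iff bisectionD[OF assms] by blast

text \<open>A partition of unity on the compact support. Finitely many bump functions \<open>h\<close>, supported
  in open bisections inside \<open>V\<close>, have a sum \<open>H\<close> that exceeds 1 on the support of \<open>f\<close>. The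
  functions \<open>h f / max H 1\<close> are continuous on all of \<open>V\<close>, without a case distinction
  at zeros of \<open>H\<close>, and add up to \<open>f\<close>.\<close>

lemma Cc_decompose_bisections:
  assumes V: "openin (gtop G) V" "Hausdorff_space (subtopology (gtop G) V)" and f: "f \<in> Cc G V"
  obtains F :: "'a set" and B g where "finite F"
    "\<And>i. i \<in> F \<Longrightarrow> bisection G (B i)" "\<And>i. i \<in> F \<Longrightarrow> g i \<in> Cc G (B i)"
    "f = (\<lambda>x. \<Sum>i\<in>F. g i x)"
proof -
  let ?V = "subtopology (gtop G) V"
  obtain K where fc: "continuous_map ?V euclidean f"
    and K: "compactin (gtop G) K" "K \<subseteq> V" "\<And>x. x \<notin> K \<Longrightarrow> f x = 0"
    using f Cc_iff[OF V] by blast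
  define good where "good x B h L \<longleftrightarrow> bisection G B \<and> x \<in> B \<and> B \<subseteq> V \<and>
    (\<forall>y. 0 \<le> h y) \<and> h x = (2::real) \<and> continuous_map (subtopology (gtop G) B) euclidean h \<and>
    compactin (gtop G) L \<and> L \<subseteq> B \<and> (\<forall>y. y \<notin> L \<longrightarrow> h y = 0)" for x B h L
  have "\<exists>B h L. good x B h L" if x: "x \<in> K" for x
  proof -
    have "x \<in> V" using x K by auto
    then obtain B where B: "bisection G B" "x \<in> B" "B \<subseteq> V" using bisection_nhd[OF V(1)] by blast
    show ?thesis
      by (rule bump_function[OF B(1,2)]) (use B in \<open>auto simp: good_def\<close>)
  qed
  then obtain B h L where good: "\<And>x. x \<in> K \<Longrightarrow> good x (B x) (h x) (L x)"
    by metis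
  have BhL: "\<And>x. x \<in> K \<Longrightarrow> bisection G (B x)" "\<And>x. x \<in> K \<Longrightarrow> x \<in> B x"
    "\<And>x. x \<in> K \<Longrightarrow> B x \<subseteq> V" "\<And>x y. x \<in> K \<Longrightarrow> 0 \<le> h x y" "\<And>x. x \<in> K \<Longrightarrow> h x x = 2"
    "\<And>x. x \<in> K \<Longrightarrow> continuous_map (subtopology (gtop G) (B x)) euclidean (h x)"
    "\<And>x. x \<in> K \<Longrightarrow> compactin (gtop G) (L x)" "\<And>x. x \<in> K \<Longrightarrow> L x \<subseteq> B x"
    "\<And>x y. x \<in> K \<Longrightarrow> y \<notin> L x \<Longrightarrow> h x y = 0"
    using good by (simp_all add: good_def)
  have hV: "continuous_map ?V euclidean (h x)" if "x \<in> K" for x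
    by (rule continuous_map_extend_by_zero[OF V bisectionD(1)[OF BhL(1)] BhL(3) BhL(7,8,9,6)])
      (use that in auto)
  define O' where "O' x = {y \<in> V. h x y > 1}" for x
  have topV: "topspace ?V = V" using V(1) openin_subset by auto
  have O': "openin (gtop G) (O' x)" if "x \<in> K" for x
  proof -
    have "openin euclidean {1::real<..}" by simp
    from openin_continuous_map_preimage[OF hV[OF that] this]
    have "openin ?V (O' x)" unfolding topV by (simp add: O'_def)
    then show ?thesis using V(1) openin_trans_full by blast
  qed
  have "K \<subseteq> \<Union> (O' ` K)" using K(2) BhL(5) by (force simp: O'_def)
  then obtain \<F> where \<F>: "finite \<F>" "\<F> \<subseteq> O' ` K" "K \<subseteq> \<Union> \<F>"
    using compactinD[OF K(1), of "O' ` K"] O' by blast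
  then obtain F where F: "F \<subseteq> K" "finite F" "\<F> = O' ` F"
    using finite_subset_image by metis
  define H where "H y = (\<Sum>x\<in>F. h x y)" for y
  define g where "g x y = complex_of_real (h x y / max (H y) 1) * f y" for x y
  have H1: "H y \<ge> 1" if y: "y \<in> K" for y
  proof -
    obtain x where x: "x \<in> F" "y \<in> O' x" using \<F>(3) F(3) y by auto
    have "h x y \<le> H y"
      unfolding H_def by (rule member_le_sum) (use x F BhL(4) in auto)
    then show ?thesis using x by (simp add: O'_def)
  qed
  have Hc: "continuous_map ?V euclidean H"
    unfolding H_def by (rule continuous_map_sum) (use F hV in auto)
  have gc: "continuous_map ?V euclidean (g x)" if "x \<in> F" for x
    unfolding g_def
  proof (rule continuous_map_mult_complex[OF _ fc])
    have hx: "continuous_map ?V euclidean (h x)" using hV F that by blast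
    show "continuous_map ?V euclidean (\<lambda>y. complex_of_real (h x y / max (H y) 1))"
      using hx Hc by (auto simp: continuous_map_atin intro!: tendsto_intros)
  qed
  have "g x \<in> Cc G (B x)" if x: "x \<in> F" for x
  proof -
    have xK: "x \<in> K" using x F by auto
    have "continuous_map (subtopology (gtop G) (B x)) euclidean (g x)"
      using gc[OF x] BhL(3)[OF xK] continuous_map_from_subtopology_mono by blast
    then show ?thesis
      using BhL(7,8,9)[OF xK] unfolding Cc_bisection_iff[OF BhL(1)[OF xK]]
      by (intro conjI exI[of _ "L x"]) (auto simp: g_def)
  qed
  moreover have "f y = (\<Sum>x\<in>F. g x y)" for y
  proof (cases "y \<in> K")
    case True
    have "(\<Sum>x\<in>F. g x y) = complex_of_real (\<Sum>x\<in>F. h x y / max (H y) 1) * f y"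
      by (simp add: g_def sum_distrib_right)
    also have "(\<Sum>x\<in>F. h x y / max (H y) 1) = 1"
      using H1[OF True] by (simp add: sum_divide_distrib[symmetric] H_def[symmetric] max_def)
    finally show ?thesis by simp
  qed (simp add: K(3) g_def)
  ultimately show ?thesis using that[of F B g] F BhL(1) by blast
qed

end

lemma A0_zero: "(\<lambda>x. 0) \<in> A0 G"
  unfolding A0_def by (auto intro!: exI[of _ "0::nat"])

lemma A0_add_Cc:
  assumes f: "f \<in> A0 G" and V: "openin (gtop G) V" "Hausdorff_space (subtopology (gtop G) V)" "g \<in> Cc G V"
  shows "(\<lambda>x. f x + c * g x) \<in> A0 G"
proof -
  obtain n :: nat and c' g' where n: "\<forall>i<n. \<exists>V. openin (gtop G) V \<and>
      Hausdorff_space (subtopology (gtop G) V) \<and> g' i \<in> Cc G V"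
    "f = (\<lambda>x. \<Sum>i<n. c' i * g' i x)" using f by (auto simp: A0_def)
  have sum: "(\<lambda>x. f x + c * g x) = (\<lambda>x. \<Sum>i<Suc n. (c'(n := c)) i * (g'(n := g)) i x)"
    unfolding n(2) by (auto simp: fun_eq_iff intro!: sum.cong)
  show ?thesis
    unfolding A0_def mem_Collect_eq
    using n(1) V sum by (intro exI[of _ "Suc n"] exI[of _ "c'(n := c)"] exI[of _ "g'(n := g)"])
      (auto simp: less_Suc_eq)
qed

lemma A0_span_induct [consumes 1, case_names zero add]:
  assumes f: "f \<in> A0 G" and zero: "P (\<lambda>x. 0)"
    and add: "\<And>f g c V. f \<in> A0 G \<Longrightarrow> P f \<Longrightarrow> openin (gtop G) V \<Longrightarrow>
      Hausdorff_space (subtopology (gtop G) V) \<Longrightarrow> g \<in> Cc G V \<Longrightarrow> P (\<lambda>x. f x + c * g x)"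
  shows "P f"
proof -
  obtain n :: nat and c g where n: "\<And>i. i < n \<Longrightarrow> \<exists>V. openin (gtop G) V \<and>
      Hausdorff_space (subtopology (gtop G) V) \<and> g i \<in> Cc G V"
    and f: "f = (\<lambda>x. \<Sum>i<n. c i * g i x)" using f by (auto simp: A0_def)
  have "(\<lambda>x. \<Sum>i<m. c i * g i x) \<in> A0 G \<and> P (\<lambda>x. \<Sum>i<m. c i * g i x)" if "m \<le> n" for m
    using that
  proof (induction m)
    case 0
    then show ?case by (simp add: zero A0_zero)
  next
    case (Suc m)
    obtain V where "openin (gtop G) V" "Hausdorff_space (subtopology (gtop G) V)" "g m \<in> Cc G V"
      using n[of m] Suc by auto
    then show ?case using Suc A0_add_Cc[of "\<lambda>x. \<Sum>i<m. c i * g i x" G V "g m" "c m"]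
      add[of "\<lambda>x. \<Sum>i<m. c i * g i x" V "g m" "c m"] by simp
  qed
  then show ?thesis using f by auto
qed

lemma A0_add:
  assumes f: "f \<in> A0 G" and g: "g \<in> A0 G"
  shows "(\<lambda>x. f x + g x) \<in> A0 G"
  using g
proof (induction g rule: A0_span_induct)
  case (add g h c V)
  then show ?case using A0_add_Cc[of "\<lambda>x. f x + g x" G V h c] by (simp add: add.assoc)
qed (simp add: f)

lemma A0_scale:
  assumes f: "f \<in> A0 G"
  shows "(\<lambda>x. c * f x) \<in> A0 G"
  using f
proof (induction f rule: A0_span_induct)
  case (add f h c' V)
  then show ?case using A0_add_Cc[of "\<lambda>x. c * f x" G V h "c * c'"] by (simp add: distrib_left mult.assoc)
qed (simp add: A0_zero)

context etale
begin

lemma Cc_bisection_A0: "bisection G B \<Longrightarrow> f \<in> Cc G B \<Longrightarrow> f \<in> A0 G"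
  using A0_add_Cc[OF A0_zero, of G B f 1] bisectionD by simp

lemma Cc_bisection_scale:
  assumes B: "bisection G B" and f: "f \<in> Cc G B"
  shows "(\<lambda>x. c * f x) \<in> Cc G B"
  using f unfolding Cc_bisection_iff[OF B] by (auto intro!: continuous_map_mult_complex)

text \<open>The working form of the reduction to open bisections: additive properties of elements of
  \<open>\<A>\<^sub>0(\<G>)\<close> need only be checked for functions supported in a single open bisection.\<close>

lemma A0_induct [consumes 1, case_names zero add]:
  assumes f: "f \<in> A0 G" and zero: "P (\<lambda>x. 0)"
    and add: "\<And>f g B. f \<in> A0 G \<Longrightarrow> P f \<Longrightarrow> bisection G B \<Longrightarrow> g \<in> Cc G B \<Longrightarrow> P (\<lambda>x. f x + g x)"
  shows "P f"
  using f
proof (induction f rule: A0_span_induct)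
  case (add f g c V)
  obtain F :: "'a set" and B g' where F: "finite F" "\<And>i. i \<in> F \<Longrightarrow> bisection G (B i)"
    "\<And>i. i \<in> F \<Longrightarrow> g' i \<in> Cc G (B i)" "g = (\<lambda>x. \<Sum>i\<in>F. g' i x)"
    using Cc_decompose_bisections[OF add.hyps(2,3,4)] by blast
  have "(\<lambda>x. f x + c * (\<Sum>i\<in>F'. g' i x)) \<in> A0 G \<and> P (\<lambda>x. f x + c * (\<Sum>i\<in>F'. g' i x))"
    if "finite F'" "F' \<subseteq> F" for F'
    using that
  proof (induction F' rule: finite_induct)
    case empty
    then show ?case using add by simp
  next
    case (insert i F')
    let ?f = "\<lambda>x. f x + c * (\<Sum>i\<in>F'. g' i x)"
    have B: "bisection G (B i)" and g: "(\<lambda>x. c * g' i x) \<in> Cc G (B i)"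
      using insert.prems F Cc_bisection_scale by auto
    have "(\<lambda>x. f x + c * (\<Sum>i\<in>insert i F'. g' i x)) = (\<lambda>x. ?f x + c * g' i x)"
      using insert by (simp add: fun_eq_iff algebra_simps)
    then show ?case
      using insert assms(3)[OF _ _ B g, of ?f] A0_add[of ?f G] Cc_bisection_A0[OF B g] by simp
  qed
  then show ?case using F by simp
qed (rule zero)

end

context etale
begin

section \<open>Convolution on fibres\<close>

text \<open>The factorizations \<open>w = x y\<close> are parametrized by \<open>y\<close>, which ranges over the arrows with the
  source of \<open>w\<close>. In this form the convolution makes sense as an operator on
  \<open>\<ell>\<^sub>2\<close>: the value at \<open>w\<close> involves the second factor only on
  the source fibre through \<open>w\<close>.\<close>

lemma convolution_eq:
  "convolution G f g w =
    (if w \<in> \<G> then \<Sum>\<^sub>\<infinity>y\<in>fibre G (d w). f (w \<cdot> iv y) * g y else 0)"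
proof (cases "w \<in> \<G>")
  case True
  let ?P = "{(x, y). (x, y) \<in> composable G \<and> x \<cdot> y = w}"
  have "bij_betw (\<lambda>y. (w \<cdot> iv y, y)) (fibre G (d w)) ?P"
    unfolding bij_betw_def
  proof
    show "inj_on (\<lambda>y. (w \<cdot> iv y, y)) (fibre G (d w))" by (rule inj_onI) simp
    show "(\<lambda>y. (w \<cdot> iv y, y)) ` fibre G (d w) = ?P"
    proof (intro equalityI subsetI)
      fix p assume "p \<in> (\<lambda>y. (w \<cdot> iv y, y)) ` fibre G (d w)"
      then obtain y where y: "y \<in> \<G>" "d y = d w" "p = (w \<cdot> iv y, y)" by (auto simp: fibre_def)
      then show "p \<in> ?P" using True by (simp add: composable_def)
    next
      fix p assume "p \<in> ?P"
      then obtain x y where p: "p = (x, y)" "x \<in> \<G>" "y \<in> \<G>" "d x = r y" "x \<cdot> y = w"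
        by (auto simp: composable_def)
      then have "d y = d w" "x = w \<cdot> iv y" by auto
      then show "p \<in> (\<lambda>y. (w \<cdot> iv y, y)) ` fibre G (d w)" using p by (auto simp: fibre_def)
    qed
  qed
  from infsum_reindex_bij_betw[OF this, of "\<lambda>(x, y). f x * g y"]
  show ?thesis using True by (simp add: convolution_def)
next
  case False
  then have e: "{(x, y). (x, y) \<in> composable G \<and> x \<cdot> y = w} = {}" by (auto simp: composable_def)
  show ?thesis unfolding convolution_def e using False by simp
qed

lemma convolution_delta:
  assumes z: "z \<in> \<G>"
  shows "convolution G f (delta z) w = (if w \<in> \<G> \<and> d w = d z then f (w \<cdot> iv z) else 0)"
proof (cases "w \<in> \<G> \<and> d w = d z")
  case True
  have "(\<Sum>\<^sub>\<infinity>y\<in>fibre G (d w). f (w \<cdot> iv y) * delta z y) = (\<Sum>\<^sub>\<infinity>y\<in>{z}. f (w \<cdot> iv y) * delta z y)"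
    by (rule infsum_cong_neutral) (use True z in \<open>auto simp: fibre_def delta_def\<close>)
  then show ?thesis using True by (simp add: convolution_eq delta_def)
next
  case False
  have "(\<Sum>\<^sub>\<infinity>y\<in>fibre G (d w). f (w \<cdot> iv y) * delta z y) = 0" if "w \<in> \<G>"
    by (rule infsum_0) (use False that in \<open>auto simp: fibre_def delta_def\<close>)
  then show ?thesis using False by (simp add: convolution_eq)
qed

lemma A0_finite_range_fibre:
  assumes "f \<in> A0 G"
  shows "finite {x. f x \<noteq> 0 \<and> r x = u}"
  using assms
proof (induction f rule: A0_induct)
  case (add f g B)
  have "inj_on (rng G) {x. g x \<noteq> 0 \<and> r x = u}"
    using add bisectionD(4)[OF add.hyps(2)] by (auto simp: Cc_def intro: inj_on_subset)
  moreover have "finite (rng G ` {x. g x \<noteq> 0 \<and> r x = u})" by (rule finite_subset[of _ "{u}"]) auto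
  ultimately have "finite {x. g x \<noteq> 0 \<and> r x = u}" using finite_imageD by blast
  with add.IH show ?case
    by (rule finite_subset[OF _ finite_UnI, rotated]) auto
qed simp

text \<open>The element \<open>f\<close> of \<open>\<A>\<^sub>0(\<G>)\<close> has finite support on each range fibre, so the sum is finite for an
  arbitrary second factor. This gives bilinearity of convolution without any growth condition.\<close>

lemma convolution_summable:
  assumes f: "f \<in> A0 G" and w: "w \<in> \<G>"
  shows "(\<lambda>y. f (w \<cdot> iv y) * \<xi> y) summable_on fibre G (d w)"
proof (rule finite_nonzero_values_imp_summable_on)
  let ?S = "{y \<in> fibre G (d w). f (w \<cdot> iv y) * \<xi> y \<noteq> 0}"
  have "y = iv (w \<cdot> iv y) \<cdot> w" if "y \<in> fibre G (d w)" for y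
    using that w by (simp add: fibre_def iv_prod)
  then have "inj_on (\<lambda>y. w \<cdot> iv y) ?S" by (intro inj_on_inverseI[where g = "\<lambda>x. iv x \<cdot> w"]) auto
  moreover have "finite ((\<lambda>y. w \<cdot> iv y) ` ?S)"
    by (rule finite_subset[OF _ A0_finite_range_fibre[OF f, of "r w"]])
      (use w in \<open>auto simp: fibre_def\<close>)
  ultimately show "finite ?S" using finite_imageD by blast
qed

lemma convolution_add_left:
  assumes "f \<in> A0 G" "g \<in> A0 G"
  shows "convolution G (\<lambda>x. f x + g x) \<xi> = (\<lambda>w. convolution G f \<xi> w + convolution G g \<xi> w)"
  using infsum_add[OF convolution_summable[OF assms(1)] convolution_summable[OF assms(2)]]
  by (auto simp: fun_eq_iff convolution_eq distrib_right)

lemma convolution_add_right: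
  assumes "f \<in> A0 G"
  shows "convolution G f (\<lambda>x. \<xi> x + \<eta> x) = (\<lambda>w. convolution G f \<xi> w + convolution G f \<eta> w)"
  using infsum_add[OF convolution_summable[OF assms] convolution_summable[OF assms]]
  by (auto simp: fun_eq_iff convolution_eq distrib_left)

lemma convolution_scale_left: "convolution G (\<lambda>x. c * f x) \<xi> = (\<lambda>w. c * convolution G f \<xi> w)"
  by (auto simp: fun_eq_iff convolution_eq mult.assoc infsum_cmult_right')

lemma convolution_scale_right: "convolution G f (\<lambda>x. c * \<xi> x) = (\<lambda>w. c * convolution G f \<xi> w)"
  by (auto simp: fun_eq_iff convolution_eq mult.left_commute infsum_cmult_right')

text \<open>For \<open>f\<close> supported in a bisection, at most one factorization of \<open>w\<close> contributes to the
  convolution.\<close>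

lemma convolution_bisection:
  assumes B: "bisection G B" and f: "\<forall>x. x \<notin> B \<longrightarrow> f x = 0"
  shows "x \<in> B \<Longrightarrow> w \<in> \<G> \<Longrightarrow> r x = r w \<Longrightarrow> convolution G f \<xi> w = f x * \<xi> (iv x \<cdot> w)"
    and "r w \<notin> rng G ` B \<Longrightarrow> convolution G f \<xi> w = 0"
proof -
  { assume x: "x \<in> B" and w: "w \<in> \<G>" and rw: "r x = r w"
    have xG: "x \<in> \<G>" using x bisectionD(2)[OF B] by auto
    have "(\<Sum>\<^sub>\<infinity>y\<in>fibre G (d w). f (w \<cdot> iv y) * \<xi> y) = (\<Sum>\<^sub>\<infinity>y\<in>{iv x \<cdot> w}. f (w \<cdot> iv y) * \<xi> y)"
    proof (rule infsum_cong_neutral)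
      fix y assume "y \<in> {iv x \<cdot> w} - fibre G (d w)"
      then show "f (w \<cdot> iv y) * \<xi> y = 0" using xG w rw by (simp add: fibre_def)
    next
      fix y assume y: "y \<in> fibre G (d w) - {iv x \<cdot> w}"
      then have yG: "y \<in> \<G>" "d y = d w" by (auto simp: fibre_def)
      have "w \<cdot> iv y \<notin> B"
      proof
        assume "w \<cdot> iv y \<in> B"
        moreover have "r (w \<cdot> iv y) = r x" using yG w rw by simp
        ultimately have "w \<cdot> iv y = x" using x bisectionD(4)[OF B] by (meson inj_onD)
        then have "iv x \<cdot> w = y" using yG w iv_prod[of w "iv y"] by auto
        then show False using y by simp
      qed
      then show "f (w \<cdot> iv y) * \<xi> y = 0" by (simp add: f)
    qed simp
    then show "convolution G f \<xi> w = f x * \<xi> (iv x \<cdot> w)"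
      using xG w rw by (simp add: convolution_eq iv_prod) }
  { assume n: "r w \<notin> rng G ` B"
    have "f (w \<cdot> iv y) = 0" if "w \<in> \<G>" "y \<in> fibre G (d w)" for y
    proof (rule f[rule_format], rule notI)
      assume "w \<cdot> iv y \<in> B"
      then have "r (w \<cdot> iv y) \<in> rng G ` B" by blast
      then show False using n that by (simp add: fibre_def)
    qed
    then show "convolution G f \<xi> w = 0" by (simp add: convolution_eq infsum_0) }
qed

section \<open>The *-algebra of a groupoid\<close>

lemma Cc_inverse_bisection:
  assumes B: "bisection G B" and f: "f \<in> Cc G B"
  defines "B' \<equiv> {x \<in> \<G>. iv x \<in> B}"
  shows "bisection G B'" "involution G f \<in> Cc G B'"
proof -
  note BD = bisectionD[OF B]
  show B': "bisection G B'"
    unfolding bisection_def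
  proof (intro conjI)
    show "openin (gtop G) B'"
      unfolding B'_def by (rule openin_continuous_map_preimage[OF continuous_iv BD(1)])
    show "inj_on (src G) B'" "inj_on (rng G) B'"
      using BD(3,4) unfolding B'_def inj_on_def by (metis (no_types, lifting) arrow_simps(10,11) iv_iv mem_Collect_eq)+
  qed
  obtain K where fc: "continuous_map (subtopology (gtop G) B) euclidean f"
    and K: "compactin (gtop G) K" "K \<subseteq> B" "\<And>x. x \<notin> K \<Longrightarrow> f x = 0"
    using f Cc_bisection_iff[OF B] by blast
  have "continuous_map (subtopology (gtop G) B') (subtopology (gtop G) B) (ginv G)"
    by (auto simp: continuous_map_in_subtopology B'_def intro!: continuous_map_from_subtopology continuous_iv)
  from continuous_map_compose[OF this fc]
  have "continuous_map (subtopology (gtop G) B') euclidean (\<lambda>x. cnj (f (iv x)))"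
    by (auto simp: o_def continuous_map_atin intro!: tendsto_cnj)
  then have "continuous_map (subtopology (gtop G) B') euclidean (involution G f)"
    by (rule continuous_map_eq) (auto simp: involution_def)
  moreover have "compactin (gtop G) (ginv G ` K)" by (rule image_compactin[OF K(1) continuous_iv])
  moreover have "ginv G ` K \<subseteq> B'" using K(2) BD(2) by (auto simp: B'_def subset_iff)
  moreover have "involution G f x = 0" if "x \<notin> ginv G ` K" for x
    using that K(3) by (metis complex_cnj_zero image_eqI involution_def iv_iv)
  ultimately show "involution G f \<in> Cc G B'" unfolding Cc_bisection_iff[OF B'] by blast
qed

lemma A0_involution:
  assumes "f \<in> A0 G"
  shows "involution G f \<in> A0 G"
  using assms
proof (induction f rule: A0_induct)
  case zero
  have "involution G (\<lambda>x. 0) = (\<lambda>x. 0)" by (simp add: involution_def fun_eq_iff)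
  then show ?case by (simp add: A0_zero)
next
  case (add f g B)
  have "involution G (\<lambda>x. f x + g x) = (\<lambda>x. involution G f x + involution G g x)"
    by (simp add: involution_def fun_eq_iff)
  moreover have "involution G g \<in> A0 G"
    using Cc_inverse_bisection[OF add.hyps(2,3)] Cc_bisection_A0 by blast
  ultimately show ?case using A0_add[OF add.IH] by simp
qed

text \<open>Composable pairs form a closed set because the unit space is Hausdorff.\<close>

lemma compactin_product:
  assumes "compactin (gtop G) K" "compactin (gtop G) L"
  shows "compactin (gtop G) ((\<lambda>(x, y). x \<cdot> y) ` (composable G \<inter> K \<times> L))"
proof -
  let ?GG = "prod_topology (gtop G) (gtop G)"
  have c: "continuous_map ?GG (unit_space G) (src G \<circ> fst)" "continuous_map ?GG (unit_space G) (rng G \<circ> snd)"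
    by (rule continuous_map_compose[OF _ local_homeomorphism_continuous_map[OF local_homeo(1)]]
        continuous_map_compose[OF _ local_homeomorphism_continuous_map[OF local_homeo(2)]],
        simp add: continuous_map_fst continuous_map_snd)+
  have "closedin ?GG {p \<in> topspace ?GG. (src G \<circ> fst) p = (rng G \<circ> snd) p}"
    by (rule closedin_continuous_maps_eq[OF unit_space(2) c])
  also have "{p \<in> topspace ?GG. (src G \<circ> fst) p = (rng G \<circ> snd) p} = composable G"
    by (auto simp: composable_def)
  finally have "compactin ?GG (composable G \<inter> K \<times> L)"
    by (rule closed_Int_compactin) (simp add: compactin_Times assms)
  then have "compactin (subtopology ?GG (composable G)) (composable G \<inter> K \<times> L)"
    by (simp add: compactin_subtopology)
  from image_compactin[OF this continuous_prod] show ?thesis .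
qed

text \<open>The product of two open bisections \<open>B\<close> and \<open>C\<close> is an open bisection: \<open>z\<close> lies in it iff
  the arrow \<open>a z \<in> B\<close> with the range of \<open>z\<close>, which depends continuously on \<open>z\<close>, exists
  and \<open>a(z)\<^sup>-\<^sup>1 z \<in> C\<close>. The convolution of functions supported in \<open>B\<close> and \<open>C\<close> is the
  product of their values at \<open>a z\<close> and \<open>a(z)\<^sup>-\<^sup>1 z\<close>.\<close>

lemma convolution_Cc_A0:
  assumes B: "bisection G B" and f: "f \<in> Cc G B" and C: "bisection G C" and g: "g \<in> Cc G C"
  shows "convolution G f g \<in> A0 G"
proof -
  let ?X = "gtop G"
  note BD = bisectionD[OF B] and CD = bisectionD[OF C]
  note rc = local_homeomorphism_continuous_map[OF local_homeo(2)]
  obtain K where fc: "continuous_map (subtopology ?X B) euclidean f"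
    and K: "compactin ?X K" "K \<subseteq> B" "\<And>x. x \<notin> K \<Longrightarrow> f x = 0"
    using f Cc_bisection_iff[OF B] by blast
  obtain L where gc: "continuous_map (subtopology ?X C) euclidean g"
    and L: "compactin ?X L" "L \<subseteq> C" "\<And>x. x \<notin> L \<Longrightarrow> g x = 0"
    using g Cc_bisection_iff[OF C] by blast
  have f0: "f x = 0" if "x \<notin> B" for x using that K by blast
  have g0: "g x = 0" if "x \<notin> C" for x using that L by blast
  obtain \<sigma> where "homeomorphic_maps (subtopology ?X B) (subtopology (unit_space G) (rng G ` B)) (rng G) \<sigma>"
    using local_homeomorphism_restrict[OF local_homeo(2) BD(1,4)] by (auto simp: homeomorphic_map_maps)
  then have \<sigma>c: "continuous_map (subtopology (unit_space G) (rng G ` B)) (subtopology ?X B) \<sigma>"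
    and \<sigma>: "\<And>x. x \<in> B \<Longrightarrow> \<sigma> (r x) = x"
    using BD(2) by (auto simp: homeomorphic_maps_def subset_iff)
  define P where "P = {z \<in> \<G>. r z \<in> rng G ` B}"
  define a where "a z = \<sigma> (r z)" for z
  define b where "b z = iv (a z) \<cdot> z" for z
  define BC where "BC = {z \<in> P. b z \<in> C}"
  have PG: "P \<subseteq> \<G>" by (auto simp: P_def)
  have aP: "a z \<in> B" "r (a z) = r z" if "z \<in> P" for z
    using that \<sigma> by (auto simp: P_def a_def)
  then have aG: "a z \<in> \<G>" if "z \<in> P" for z using that BD(2) by blast
  have bP: "b z \<in> \<G>" "d (b z) = d z" "r (b z) = d (a z)" "a z \<cdot> b z = z" if "z \<in> P" for z
    using that aG[OF that] aP[OF that] PG by (auto simp: b_def subset_iff)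
  have uniq: "x \<cdot> y \<in> BC" "a (x \<cdot> y) = x" "b (x \<cdot> y) = y"
    if "x \<in> B" "y \<in> C" "d x = r y" for x y
  proof -
    have xy: "x \<in> \<G>" "y \<in> \<G>" using that BD(2) CD(2) by auto
    then show axy: "a (x \<cdot> y) = x" using that \<sigma> by (simp add: a_def)
    show bxy: "b (x \<cdot> y) = y" using xy that by (simp add: b_def axy)
    show "x \<cdot> y \<in> BC" using xy that bxy by (auto simp: BC_def P_def)
  qed
  have "openin (unit_space G) (rng G ` B)"
    using local_homeomorphism_open_map[OF local_homeo(2)] BD(1) by (simp add: open_map_def)
  then have oP: "openin ?X P" unfolding P_def by (rule openin_continuous_map_preimage[OF rc])
  have topP: "topspace (subtopology ?X P) = P" using PG by auto
  have "continuous_map (subtopology ?X P) (subtopology (unit_space G) (rng G ` B)) (rng G)"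
    unfolding continuous_map_in_subtopology[of _ "unit_space G"]
    using rc by (auto simp: continuous_map_from_subtopology P_def)
  from continuous_map_compose[OF this \<sigma>c]
  have acB: "continuous_map (subtopology ?X P) (subtopology ?X B) a"
    by (simp add: o_def a_def[abs_def])
  then have ac: "continuous_map (subtopology ?X P) ?X a" using continuous_map_into_fulltopology by blast
  have "continuous_map (subtopology ?X P) (subtopology (prod_topology ?X ?X) (composable G)) (\<lambda>z. (iv (a z), z))"
    unfolding continuous_map_in_subtopology continuous_map_pairwise
  proof (intro conjI)
    show "continuous_map (subtopology ?X P) ?X (fst \<circ> (\<lambda>z. (iv (a z), z)))"
      using continuous_map_compose[OF ac continuous_iv] by (simp add: o_def)
    show "continuous_map (subtopology ?X P) ?X (snd \<circ> (\<lambda>z. (iv (a z), z)))"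
      by (simp add: o_def continuous_map_from_subtopology)
    show "(\<lambda>z. (iv (a z), z)) \<in> topspace (subtopology ?X P) \<rightarrow> composable G"
      unfolding topP using aG aP PG by (auto simp: composable_def subset_iff)
  qed
  from continuous_map_compose[OF this continuous_prod]
  have bc: "continuous_map (subtopology ?X P) ?X b" by (simp add: o_def b_def[abs_def])
  have "openin (subtopology ?X P) BC"
    using openin_continuous_map_preimage[OF bc CD(1)] unfolding topP BC_def .
  then have oBC: "openin ?X BC" using oP openin_trans_full by blast
  have BCP: "BC \<subseteq> P" by (auto simp: BC_def)
  have BC: "bisection G BC"
    unfolding bisection_def
  proof (intro conjI oBC inj_onI)
    fix z z' assume z: "z \<in> BC" "z' \<in> BC" and "d z = d z'"
    then have bb: "b z = b z'" using bP CD(3) unfolding BC_def by (metis (lifting) inj_onD mem_Collect_eq)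
    then have "a z = a z'" using z aP bP BD(3) unfolding BC_def by (metis (lifting) inj_onD mem_Collect_eq)
    then show "z = z'" using bb bP(4) z BCP by (metis subsetD)
  next
    fix z z' assume z: "z \<in> BC" "z' \<in> BC" and "r z = r z'"
    then have aa: "a z = a z'" by (simp add: a_def)
    then have "b z = b z'" using z bP CD(4) unfolding BC_def by (metis (lifting) inj_onD mem_Collect_eq)
    then show "z = z'" using aa bP(4) z BCP by (metis subsetD)
  qed
  have val: "convolution G f g z = f (a z) * g (b z)" if "z \<in> P" for z
    unfolding b_def using that convolution_bisection(1)[OF B, of f "a z" z g] f0 aP PG by auto
  have val0: "convolution G f g z = 0" if z: "z \<notin> BC" for z
  proof (cases "z \<in> P")
    case True
    then show ?thesis using z val g0 by (simp add: BC_def)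
  next
    case False
    then show ?thesis
      using convolution_bisection(2)[OF B, of f z g] f0 by (auto simp: P_def convolution_eq)
  qed
  have acBC: "continuous_map (subtopology ?X BC) (subtopology ?X B) a"
    using acB BCP continuous_map_from_subtopology_mono by blast
  have bcBC: "continuous_map (subtopology ?X BC) (subtopology ?X C) b"
    unfolding continuous_map_in_subtopology
    using continuous_map_from_subtopology_mono[OF bc BCP] by (auto simp: BC_def)
  have "continuous_map (subtopology ?X BC) euclidean (\<lambda>z. f (a z) * g (b z))"
    using continuous_map_compose[OF acBC fc] continuous_map_compose[OF bcBC gc]
    by (intro continuous_map_mult_complex) (simp_all add: o_def)
  then have "continuous_map (subtopology ?X BC) euclidean (convolution G f g)"
    by (rule continuous_map_eq) (use val BCP in auto)
  moreover have "(\<lambda>(x, y). x \<cdot> y) ` (composable G \<inter> K \<times> L) \<subseteq> BC"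
    using uniq(1) K(2) L(2) by (auto simp: composable_def)
  moreover have "convolution G f g z = 0" if z: "z \<notin> (\<lambda>(x, y). x \<cdot> y) ` (composable G \<inter> K \<times> L)" for z
  proof (rule ccontr)
    assume n: "convolution G f g z \<noteq> 0"
    then have zP: "z \<in> P" using val0 BCP by blast
    then have "a z \<in> K" "b z \<in> L" using n val K(3) L(3) by auto
    moreover have "(a z, b z) \<in> composable G" using zP aG bP by (simp add: composable_def)
    ultimately show False using z bP(4)[OF zP] by (force simp: image_iff)
  qed
  ultimately have "convolution G f g \<in> Cc G BC"
    unfolding Cc_bisection_iff[OF BC] using compactin_product[OF K(1) L(1)] by blast
  then show ?thesis using Cc_bisection_A0[OF BC] by blast
qed

lemma A0_convolution:
  assumes f: "f \<in> A0 G" and g: "g \<in> A0 G"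
  shows "convolution G f g \<in> A0 G"
  using f
proof (induction f rule: A0_induct)
  case zero
  have "convolution G (\<lambda>x. 0) g = (\<lambda>x. 0)" by (simp add: fun_eq_iff convolution_eq)
  then show ?case by (simp add: A0_zero)
next
  case (add f h B)
  have h: "h \<in> A0 G" using Cc_bisection_A0 add.hyps by blast
  have "convolution G h g \<in> A0 G"
    using g
  proof (induction g rule: A0_induct)
    case zero
    have "convolution G h (\<lambda>x. 0) = (\<lambda>x. 0)" by (simp add: fun_eq_iff convolution_eq)
    then show ?case by (simp add: A0_zero)
  next
    case (add g k C)
    then show ?case
      unfolding convolution_add_right[OF h]
      using A0_add convolution_Cc_A0[OF \<open>bisection G B\<close> \<open>h \<in> Cc G B\<close>] by blast
  qed
  then show ?case unfolding convolution_add_left[OF add.hyps(1) h] using A0_add add.IH by blast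
qed

section \<open>The regular representation as left convolution\<close>

lemma Cc_bounded:
  assumes B: "bisection G B" and f: "f \<in> Cc G B"
  obtains M where "0 \<le> M" "\<And>x. cmod (f x) \<le> M"
proof -
  obtain K where fc: "continuous_map (subtopology (gtop G) B) euclidean f"
    and K: "compactin (gtop G) K" "K \<subseteq> B" "\<And>x. x \<notin> K \<Longrightarrow> f x = 0"
    using f Cc_bisection_iff[OF B] by blast
  have "compactin euclidean (f ` K)"
    by (rule image_compactin[OF _ fc]) (simp add: compactin_subtopology K)
  then have "bounded (f ` K)" by (simp add: compact_imp_bounded)
  then obtain M where M: "\<And>x. x \<in> K \<Longrightarrow> cmod (f x) \<le> M" by (auto simp: bounded_iff)
  have "cmod (f x) \<le> max M 0" for x using M[of x] K(3)[of x] by (cases "x \<in> K") auto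
  then show ?thesis using that[of "max M 0"] by simp
qed

text \<open>Left multiplication by the inverses of the arrows of a bisection is a partial
  injection of \<open>\<G>\<close>, so a function supported in a bisection acts as a partial permutation of
  coordinates followed by multiplication with a bounded function.\<close>

lemma convolution_bisection_bounded:
  assumes B: "bisection G B" and f: "\<forall>x. x \<notin> B \<longrightarrow> f x = 0" and M: "0 \<le> M" "\<And>x. cmod (f x) \<le> M"
    and \<xi>: "\<xi> \<in> ell2 \<G>"
  shows "convolution G f \<xi> \<in> ell2 \<G>" "ell2_norm \<G> (convolution G f \<xi>) \<le> M * ell2_norm \<G> \<xi>"
proof -
  note BD = bisectionD[OF B] and conv = convolution_bisection[OF B f]
  define a where "a w = inv_into B (rng G) (r w)" for w
  define b where "b w = iv (a w) \<cdot> w" for w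
  have bound: "L2_set (\<lambda>w. cmod (convolution G f \<xi> w)) F \<le> M * ell2_norm \<G> \<xi>"
    if F: "finite F" "F \<subseteq> \<G>" for F
  proof -
    define F' where "F' = {w \<in> F. r w \<in> rng G ` B}"
    have F': "finite F'" "F' \<subseteq> F" using F by (auto simp: F'_def)
    have a: "a w \<in> B" "r (a w) = r w" if "w \<in> F'" for w
      using that by (auto simp: F'_def a_def inv_into_into f_inv_into_f)
    have aw: "a w \<in> \<G>" "w \<in> \<G>" if "w \<in> F'" for w using that a BD(2) F F' by blast+
    have b: "b w \<in> \<G>" "r (b w) = d (a w)" "a w \<cdot> b w = w" if "w \<in> F'" for w
      using a[OF that] aw[OF that] by (simp_all add: b_def)
    have inj: "inj_on b F'"
    proof (rule inj_onI)
      fix w w' assume w: "w \<in> F'" "w' \<in> F'" "b w = b w'"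
      then have "d (a w) = d (a w')" using b(2) by metis
      then have "a w = a w'" using a w BD(3) by (meson inj_onD)
      then show "w = w'" using b(3) w by metis
    qed
    have "L2_set (\<lambda>w. cmod (convolution G f \<xi> w)) F = L2_set (\<lambda>w. cmod (convolution G f \<xi> w)) F'"
      unfolding L2_set_def using F F' conv(2)
      by (intro arg_cong[where f = sqrt] sum.mono_neutral_right) (auto simp: F'_def)
    also have "\<dots> \<le> L2_set (\<lambda>w. M * cmod (\<xi> (b w))) F'"
    proof (rule L2_set_mono)
      fix w assume w: "w \<in> F'"
      have "convolution G f \<xi> w = f (a w) * \<xi> (b w)"
        unfolding b_def using conv(1) a[OF w] aw[OF w] by blast
      then show "cmod (convolution G f \<xi> w) \<le> M * cmod (\<xi> (b w))"
        by (simp add: norm_mult mult_right_mono M(2))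
    qed simp
    also have "\<dots> = M * L2_set (\<lambda>w. cmod (\<xi> (b w))) F'" by (rule L2_set_right_distrib[symmetric, OF M(1)])
    also have "L2_set (\<lambda>w. cmod (\<xi> (b w))) F' = L2_set (\<lambda>y. cmod (\<xi> y)) (b ` F')"
      unfolding L2_set_def by (simp add: sum.reindex[OF inj])
    also have "M * \<dots> \<le> M * ell2_norm \<G> \<xi>"
      using b(1) F' by (intro mult_left_mono L2_set_le_ell2_norm \<xi> M(1)) auto
    finally show ?thesis .
  qed
  have "convolution G f \<xi> w = 0" if "w \<notin> \<G>" for w using that by (simp add: convolution_eq)
  with bound show "convolution G f \<xi> \<in> ell2 \<G>" "ell2_norm \<G> (convolution G f \<xi>) \<le> M * ell2_norm \<G> \<xi>"
    using ell2_boundI[of \<G> "convolution G f \<xi>" "M * ell2_norm \<G> \<xi>"] by blast+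
qed

lemma convolution_bounded:
  assumes "f \<in> A0 G"
  shows "\<exists>C. \<forall>\<xi> \<in> ell2 \<G>. convolution G f \<xi> \<in> ell2 \<G> \<and>
    ell2_norm \<G> (convolution G f \<xi>) \<le> C * ell2_norm \<G> \<xi>"
  using assms
proof (induction f rule: A0_induct)
  case zero
  have "convolution G (\<lambda>x. 0) \<xi> = (\<lambda>x. 0)" for \<xi> by (simp add: fun_eq_iff convolution_eq)
  then show ?case by (intro exI[of _ 0]) (simp add: ell2_zero ell2_norm_def)
next
  case (add f g B)
  obtain C where C: "\<And>\<xi>. \<xi> \<in> ell2 \<G> \<Longrightarrow> convolution G f \<xi> \<in> ell2 \<G>"
    "\<And>\<xi>. \<xi> \<in> ell2 \<G> \<Longrightarrow> ell2_norm \<G> (convolution G f \<xi>) \<le> C * ell2_norm \<G> \<xi>"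
    using add.IH by blast
  obtain M where M: "0 \<le> M" "\<And>x. cmod (g x) \<le> M" using Cc_bounded[OF add.hyps(2,3)] by blast
  have g: "g \<in> A0 G" using Cc_bisection_A0 add.hyps by blast
  have g0: "\<forall>x. x \<notin> B \<longrightarrow> g x = 0" using add.hyps(3) by (simp add: Cc_def)
  note cg = convolution_bisection_bounded[OF add.hyps(2) g0 M]
  show ?case
    unfolding convolution_add_left[OF add.hyps(1) g]
  proof (intro exI[of _ "C + M"] ballI conjI)
    fix \<xi> assume \<xi>: "\<xi> \<in> ell2 \<G>"
    show "(\<lambda>w. convolution G f \<xi> w + convolution G g \<xi> w) \<in> ell2 \<G>"
      by (rule ell2_add(1)[OF C(1)[OF \<xi>] cg(1)[OF \<xi>]])
    show "ell2_norm \<G> (\<lambda>w. convolution G f \<xi> w + convolution G g \<xi> w) \<le> (C + M) * ell2_norm \<G> \<xi>"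
      using ell2_add(2)[OF C(1)[OF \<xi>] cg(1)[OF \<xi>]] C(2)[OF \<xi>] cg(2)[OF \<xi>] by (simp add: distrib_right)
  qed
qed

definition left_invariant :: "'a set \<Rightarrow> bool" where
  "left_invariant X \<longleftrightarrow> X \<subseteq> \<G> \<and> (\<forall>z\<in>X. \<forall>w\<in>\<G>. d w = d z \<longrightarrow> w \<in> X)"

lemma left_invariant_arrows: "left_invariant \<G>" and left_invariant_fibre: "left_invariant (fibre G u)"
  by (auto simp: left_invariant_def fibre_def)

lemma convolution_invariant:
  assumes X: "left_invariant X" and \<xi>: "\<And>x. x \<notin> X \<Longrightarrow> \<xi> x = 0" and w: "w \<notin> X"
  shows "convolution G f \<xi> w = 0"
proof -
  have "\<xi> y = 0" if "w \<in> \<G>" "y \<in> fibre G (d w)" for y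
    using that X \<xi>[of y] w unfolding left_invariant_def fibre_def by (metis (lifting) mem_Collect_eq)
  then show ?thesis by (simp add: convolution_eq infsum_0)
qed

text \<open>For \<open>X = \<G>\<close> and for \<open>X = \<G>\<^sub>u\<close> the operator is given by the same formula; this is what makes
  the regular representation the direct sum of the representations at the units.\<close>

lemma convolution_bounded_op:
  assumes f: "f \<in> A0 G" and X: "left_invariant X"
  shows "restrict (convolution G f) (ell2 X) \<in> bounded_ops X"
proof -
  have XG: "X \<subseteq> \<G>" using X by (simp add: left_invariant_def)
  obtain C where C: "\<And>\<xi>. \<xi> \<in> ell2 \<G> \<Longrightarrow> convolution G f \<xi> \<in> ell2 \<G>"
    "\<And>\<xi>. \<xi> \<in> ell2 \<G> \<Longrightarrow> ell2_norm \<G> (convolution G f \<xi>) \<le> C * ell2_norm \<G> \<xi>"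
    using convolution_bounded[OF f] by blast
  have mem: "convolution G f \<xi> \<in> ell2 X" if \<xi>: "\<xi> \<in> ell2 X" for \<xi>
  proof -
    have "(\<lambda>x. if x \<in> X then convolution G f \<xi> x else 0) \<in> ell2 X"
      by (rule ell2_restrict(1)[OF C(1)[OF ell2_mono(1)[OF XG \<xi>]] XG])
    moreover have "(\<lambda>x. if x \<in> X then convolution G f \<xi> x else 0) = convolution G f \<xi>"
      using convolution_invariant[OF X ell2_vanishes[OF \<xi>]] by auto
    ultimately show ?thesis by simp
  qed
  show ?thesis
  proof (rule bounded_opsI[where C = C])
    fix \<xi> assume \<xi>: "\<xi> \<in> ell2 X"
    show "ell2_norm X (convolution G f \<xi>) \<le> C * ell2_norm X \<xi>"
      using C(2)[OF ell2_mono(1)[OF XG \<xi>]] ell2_mono(2)[OF XG \<xi>] ell2_mono(2)[OF XG mem[OF \<xi>]] by simp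
  qed (auto simp: mem convolution_add_right[OF f] convolution_scale_right)
qed

lemma left_rep_eq_convolution:
  assumes f: "f \<in> A0 G" and X: "left_invariant X"
  shows "left_rep G X f = restrict (convolution G f) (ell2 X)"
proof -
  have XG: "X \<subseteq> \<G>" using X by (simp add: left_invariant_def)
  have sum: "(\<lambda>w. \<Sum>\<^sub>\<infinity>x\<in>fibre G (r z). f x * delta (x \<cdot> z) w) = convolution G f (delta z)"
    if z: "z \<in> \<G>" for z
  proof
    fix w
    have ne: "w \<noteq> x \<cdot> z" if "\<not> (w \<in> \<G> \<and> d w = d z) \<or> x \<noteq> w \<cdot> iv z" "x \<in> fibre G (r z)" for x
      using that z by (auto simp: fibre_def)
    show "(\<Sum>\<^sub>\<infinity>x\<in>fibre G (r z). f x * delta (x \<cdot> z) w) = convolution G f (delta z) w"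
    proof (cases "w \<in> \<G> \<and> d w = d z")
      case True
      have "(\<Sum>\<^sub>\<infinity>x\<in>fibre G (r z). f x * delta (x \<cdot> z) w) = (\<Sum>\<^sub>\<infinity>x\<in>{w \<cdot> iv z}. f x * delta (x \<cdot> z) w)"
        by (rule infsum_cong_neutral) (use True z ne in \<open>auto simp: fibre_def delta_def\<close>)
      then show ?thesis using True by (simp add: convolution_delta[OF z]) (simp add: z delta_def)
    next
      case False
      then have "(\<Sum>\<^sub>\<infinity>x\<in>fibre G (r z). f x * delta (x \<cdot> z) w) = 0"
        using ne by (intro infsum_0) (simp add: delta_def)
      then show ?thesis using False by (auto simp: convolution_delta z)
    qed
  qed
  show ?thesis
    unfolding left_rep_def
  proof (rule the_equality, intro conjI ballI)
    show "restrict (convolution G f) (ell2 X) \<in> bounded_ops X" by (rule convolution_bounded_op[OF f X])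
    show "restrict (convolution G f) (ell2 X) (delta z) = (\<lambda>w. \<Sum>\<^sub>\<infinity>x\<in>fibre G (r z). f x * delta (x \<cdot> z) w)"
      if "z \<in> X" for z using that XG sum by (auto simp: ell2_delta)
    show "T = restrict (convolution G f) (ell2 X)"
      if T: "T \<in> bounded_ops X \<and> (\<forall>z\<in>X. T (delta z) = (\<lambda>w. \<Sum>\<^sub>\<infinity>x\<in>fibre G (r z). f x * delta (x \<cdot> z) w))" for T
      by (rule bounded_op_ext_on_delta[OF _ convolution_bounded_op[OF f X]])
        (use T XG sum in \<open>auto simp: ell2_delta\<close>)
  qed
qed

lemma regular_rep_eq: "f \<in> A0 G \<Longrightarrow> regular_rep G f = restrict (convolution G f) (ell2 \<G>)"
  and regular_rep_bounded: "f \<in> A0 G \<Longrightarrow> regular_rep G f \<in> bounded_ops \<G>"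
  using left_rep_eq_convolution[OF _ left_invariant_arrows] convolution_bounded_op[OF _ left_invariant_arrows]
  by (simp_all add: regular_rep_def)

lemma regular_rep_add:
  assumes "f \<in> A0 G" "g \<in> A0 G"
  shows "regular_rep G (\<lambda>x. f x + g x) = aadd (op_algebra \<G>) (regular_rep G f) (regular_rep G g)"
  using assms by (auto simp: regular_rep_eq A0_add convolution_add_left intro!: restrict_ext)

lemma regular_rep_scale:
  assumes "f \<in> A0 G"
  shows "regular_rep G (\<lambda>x. c * f x) = ascale (op_algebra \<G>) c (regular_rep G f)"
  using assms by (auto simp: regular_rep_eq A0_scale convolution_scale_left intro!: restrict_ext)

text \<open>On point masses multiplicativity is the associativity of convolution, which there is a
  mere change of variables \<open>t = y z\<close> in a single sum.\<close>

lemma regular_rep_mult: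
  assumes f: "f \<in> A0 G" and g: "g \<in> A0 G"
  shows "regular_rep G (convolution G f g) = amult (op_algebra \<G>) (regular_rep G f) (regular_rep G g)"
proof (rule bounded_op_ext_on_delta)
  show "regular_rep G (convolution G f g) \<in> bounded_ops \<G>"
    by (rule regular_rep_bounded[OF A0_convolution[OF f g]])
  show "amult (op_algebra \<G>) (regular_rep G f) (regular_rep G g) \<in> bounded_ops \<G>"
    using bounded_ops_compose[OF regular_rep_bounded[OF f] regular_rep_bounded[OF g]] by simp
  fix z assume z: "z \<in> \<G>"
  have "convolution G (convolution G f g) (delta z) w = convolution G f (convolution G g (delta z)) w" for w
  proof (cases "w \<in> \<G> \<and> d w = d z")
    case True
    have bij: "bij_betw (\<lambda>y. y \<cdot> z) (fibre G (r z)) (fibre G (d w))"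
      by (rule bij_betwI[where g = "\<lambda>t. t \<cdot> iv z"]) (use z True in \<open>auto simp: fibre_def\<close>)
    have "convolution G f (convolution G g (delta z)) w
        = (\<Sum>\<^sub>\<infinity>t\<in>fibre G (d w). f (w \<cdot> iv t) * g (t \<cdot> iv z))"
      using True by (auto simp: convolution_eq[of f] convolution_delta[OF z] fibre_def intro!: infsum_cong)
    also have "\<dots> = (\<Sum>\<^sub>\<infinity>y\<in>fibre G (r z). f (w \<cdot> iv (y \<cdot> z)) * g (y \<cdot> z \<cdot> iv z))"
      by (rule infsum_reindex_bij_betw[OF bij, symmetric])
    also have "\<dots> = (\<Sum>\<^sub>\<infinity>y\<in>fibre G (r z). f (w \<cdot> iv z \<cdot> iv y) * g y)"
      by (rule infsum_cong) (use z True in \<open>auto simp: fibre_def iv_prod prod_assoc[symmetric]\<close>)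
    also have "\<dots> = convolution G (convolution G f g) (delta z) w"
      using True z by (simp add: convolution_delta convolution_eq[of f g])
    finally show ?thesis by simp
  next
    case False
    have "convolution G g (delta z) t = 0" if "w \<in> \<G>" "t \<in> fibre G (d w)" for t
      using False that z by (auto simp: convolution_delta fibre_def)
    then have "convolution G f (convolution G g (delta z)) w = 0"
      by (simp add: convolution_eq[of f] infsum_0)
    moreover have "convolution G (convolution G f g) (delta z) w = 0"
      using False by (simp only: convolution_delta[OF z] if_False)
    ultimately show ?thesis by simp
  qed
  moreover have "convolution G g (delta z) \<in> ell2 \<G>"
    using bounded_opsD(1)[OF convolution_bounded_op[OF g left_invariant_arrows] ell2_delta[OF z]]
    by (simp add: ell2_delta z)
  ultimately show "regular_rep G (convolution G f g) (delta z)
      = amult (op_algebra \<G>) (regular_rep G f) (regular_rep G g) (delta z)"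
    using z by (simp add: regular_rep_eq f g A0_convolution compose_def ell2_delta fun_eq_iff)
qed

text \<open>The matrix coefficient of \<open>\<pi>(f)\<close> from \<open>\<delta>\<^sub>z\<close> to \<open>\<delta>\<^sub>w\<close> is \<open>f(w z\<^sup>-\<^sup>1)\<close> when \<open>z\<close> and \<open>w\<close> have the same
  source. Exchanging \<open>z\<close> and \<open>w\<close> inverts \<open>w z\<^sup>-\<^sup>1\<close>, as the involution does.\<close>

lemma regular_rep_star:
  assumes f: "f \<in> A0 G"
  shows "regular_rep G (involution G f) = astar (op_algebra \<G>) (regular_rep G f)"
proof -
  let ?T = "regular_rep G f"
  note T = regular_rep_bounded[OF f]
  have "regular_rep G (involution G f) = adjoint_op \<G> ?T"
  proof (rule bounded_op_ext_on_delta[OF regular_rep_bounded[OF A0_involution[OF f]] adjoint_op(1)[OF T]])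
    fix z assume z: "z \<in> \<G>"
    note dz = ell2_delta[OF z]
    have "convolution G (involution G f) (delta z) x = adjoint_op \<G> ?T (delta z) x" for x
    proof (cases "x \<in> \<G>")
      case True
      note dx = ell2_delta[OF True]
      have "cnj (adjoint_op \<G> ?T (delta z) x) = ell2_inner \<G> (?T (delta x)) (delta z)"
        using adjoint_op(2)[OF T dx dz] by (simp add: ell2_inner_delta[OF True])
      also have "\<dots> = ?T (delta x) z"
        by (subst ell2_inner_commute) (simp add: ell2_inner_delta[OF z])
      finally have "adjoint_op \<G> ?T (delta z) x = cnj (?T (delta x) z)" by (metis complex_cnj_cnj)
      then show ?thesis
        using True z dx by (simp add: regular_rep_eq[OF f] convolution_delta involution_def iv_prod)
    next
      case False
      then show ?thesis
        using bounded_opsD(1)[OF adjoint_op(1)[OF T] dz] by (simp add: convolution_eq ell2_vanishes)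
    qed
    then show "regular_rep G (involution G f) (delta z) = adjoint_op \<G> ?T (delta z)"
      by (simp add: regular_rep_eq A0_involution f dz fun_eq_iff)
  qed
  then show ?thesis by simp
qed

end

section \<open>Decomposition over the unit space\<close>

text \<open>Used for \<open>h = \<bar>\<xi>\<bar>\<^sup>2\<close> and the source map: the squared norms of finitely many of the components
  of \<open>\<xi>\<close> in the spaces \<open>\<ell>\<^sub>2(\<G>\<^sub>u)\<close> sum to at most the squared norm of \<open>\<xi>\<close>.\<close>

lemma sum_infsum_level_sets_le:
  fixes h :: "'a \<Rightarrow> real"
  assumes h: "h summable_on A" "\<And>x. x \<in> A \<Longrightarrow> 0 \<le> h x" and U: "finite U"
  shows "(\<Sum>u\<in>U. infsum h {x \<in> A. s x = u}) \<le> infsum h A"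
proof -
  have sub: "h summable_on {x \<in> A. P x}" for P
    using h(1) by (rule summable_on_subset_banach) auto
  have "(\<Sum>u\<in>U. infsum h {x \<in> A. s x = u}) = infsum h {x \<in> A. s x \<in> U}"
    using U
  proof (induction U rule: finite_induct)
    case (insert u U)
    have "infsum h ({x \<in> A. s x = u} \<union> {x \<in> A. s x \<in> U})
        = infsum h {x \<in> A. s x = u} + infsum h {x \<in> A. s x \<in> U}"
      by (rule infsum_Un_disjoint[OF sub sub]) (use insert in auto)
    moreover have "{x \<in> A. s x = u} \<union> {x \<in> A. s x \<in> U} = {x \<in> A. s x \<in> insert u U}" by auto
    ultimately show ?case using insert by simp
  qed simp
  also have "\<dots> \<le> infsum h A"
    by (rule infsum_mono_neutral[OF sub h(1)]) (use h(2) in auto)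
  finally show ?thesis .
qed

context etale
begin

text \<open>\<open>\<ell>\<^sub>2(\<G>)\<close> is the orthogonal sum of the spaces \<open>\<ell>\<^sub>2(\<G>\<^sub>u)\<close>, and left convolution leaves each of
  them invariant, acting there as the representation at \<open>u\<close>. The norm of a block diagonal
  operator is the supremum of the norms of its blocks.\<close>

lemma op_norm_regular_rep:
  assumes f: "f \<in> A0 G"
  shows "op_norm \<G> (regular_rep G f) = red_norm G f"
proof (rule antisym)
  let ?c = "convolution G f"
  define N where "N u = op_norm (fibre G u) (regular_rep_at G u f)" for u
  have rep: "regular_rep_at G u f = restrict ?c (ell2 (fibre G u))"
      "regular_rep_at G u f \<in> bounded_ops (fibre G u)" for u
    using left_rep_eq_convolution[OF f left_invariant_fibre] convolution_bounded_op[OF f left_invariant_fibre]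
    by (simp_all add: regular_rep_at_def)
  have fG: "fibre G u \<subseteq> \<G>" for u by (auto simp: fibre_def)
  have p: "red_norm G f = Sup (insert 0 (N ` units G))" by (simp add: red_norm_def N_def[abs_def])
  have cmem: "?c \<xi> \<in> ell2 (fibre G u)" if "\<xi> \<in> ell2 (fibre G u)" for \<xi> u
    using bounded_opsD(1)[OF rep(2) that] that by (simp add: rep(1))
  have Nle: "N u \<le> op_norm \<G> (regular_rep G f)" for u
    unfolding N_def
  proof (rule op_norm_le[OF op_norm_nonneg[OF regular_rep_bounded[OF f]]])
    fix \<xi> assume \<xi>: "\<xi> \<in> ell2 (fibre G u)"
    note m = ell2_mono[OF fG \<xi>] ell2_mono[OF fG cmem[OF \<xi>]]
    show "ell2_norm (fibre G u) (regular_rep_at G u f \<xi>)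
        \<le> op_norm \<G> (regular_rep G f) * ell2_norm (fibre G u) \<xi>"
      using op_norm_bound[OF regular_rep_bounded[OF f] m(1)] m \<xi>
      by (simp add: rep(1) regular_rep_eq[OF f])
  qed
  have 0: "0 \<le> op_norm \<G> (regular_rep G f)" by (rule op_norm_nonneg[OF regular_rep_bounded[OF f]])
  show "red_norm G f \<le> op_norm \<G> (regular_rep G f)"
    unfolding p by (rule cSup_least) (use Nle 0 in auto)
  have bdd: "bdd_above (insert 0 (N ` units G))"
    using Nle 0 by (auto simp: bdd_above_def intro!: exI[of _ "op_norm \<G> (regular_rep G f)"])
  have Np: "N u \<le> red_norm G f" if "u \<in> units G" for u
    unfolding p by (rule cSup_upper[OF _ bdd]) (use that in auto)
  have p0: "0 \<le> red_norm G f" unfolding p by (rule cSup_upper[OF _ bdd]) auto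
  show "op_norm \<G> (regular_rep G f) \<le> red_norm G f"
  proof (rule op_norm_le[OF p0])
    fix \<xi> assume \<xi>: "\<xi> \<in> ell2 \<G>"
    let ?p = "red_norm G f" let ?h = "\<lambda>x. (cmod (\<xi> x))\<^sup>2"
    have sh: "?h summable_on \<G>" using \<xi> by (simp add: ell2_def)
    have "L2_set (\<lambda>w. cmod (?c \<xi> w)) F \<le> ?p * ell2_norm \<G> \<xi>" if F: "finite F" "F \<subseteq> \<G>" for F
    proof -
      have block: "(\<Sum>w\<in>{w \<in> F. d w = u}. (cmod (?c \<xi> w))\<^sup>2) \<le> ?p\<^sup>2 * infsum ?h (fibre G u)"
        if u: "u \<in> src G ` F" for u
      proof -
        have uu: "u \<in> units G" using u F by (auto simp: units_def)
        define \<xi>' where "\<xi>' x = (if x \<in> fibre G u then \<xi> x else 0)" for x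
        have \<xi>': "\<xi>' \<in> ell2 (fibre G u)" "(ell2_norm (fibre G u) \<xi>')\<^sup>2 = infsum ?h (fibre G u)"
          using ell2_restrict[OF \<xi> fG] unfolding \<xi>'_def by blast+
        have loc: "?c \<xi> w = ?c \<xi>' w" if "d w = u" for w
          using that by (auto simp: convolution_eq \<xi>'_def intro!: infsum_cong)
        have "L2_set (\<lambda>w. cmod (?c \<xi>' w)) {w \<in> F. d w = u} \<le> ell2_norm (fibre G u) (?c \<xi>')"
          by (rule L2_set_le_ell2_norm[OF cmem[OF \<xi>'(1)]]) (use F in \<open>auto simp: fibre_def\<close>)
        also have "\<dots> \<le> N u * ell2_norm (fibre G u) \<xi>'"
          using op_norm_bound[OF rep(2) \<xi>'(1)] \<xi>'(1) unfolding N_def by (simp add: rep(1))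
        also have "\<dots> \<le> ?p * ell2_norm (fibre G u) \<xi>'"
          by (rule mult_right_mono[OF Np[OF uu] ell2_norm_nonneg])
        finally have "(L2_set (\<lambda>w. cmod (?c \<xi>' w)) {w \<in> F. d w = u})\<^sup>2 \<le> (?p * ell2_norm (fibre G u) \<xi>')\<^sup>2"
          by (rule power_mono) simp
        then show ?thesis by (simp add: L2_set_def sum_nonneg power_mult_distrib \<xi>'(2) loc)
      qed
      have "(\<Sum>w\<in>F. (cmod (?c \<xi> w))\<^sup>2) = (\<Sum>u\<in>src G ` F. \<Sum>w\<in>{w \<in> F. d w = u}. (cmod (?c \<xi> w))\<^sup>2)"
        by (rule sum.image_gen[OF F(1)])
      also have "\<dots> \<le> (\<Sum>u\<in>src G ` F. ?p\<^sup>2 * infsum ?h (fibre G u))" by (rule sum_mono[OF block])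
      also have "\<dots> = ?p\<^sup>2 * (\<Sum>u\<in>src G ` F. infsum ?h {x \<in> \<G>. d x = u})"
        by (simp add: sum_distrib_left fibre_def)
      also have "\<dots> \<le> ?p\<^sup>2 * infsum ?h \<G>"
        by (intro mult_left_mono sum_infsum_level_sets_le[OF sh]) (use F in auto)
      finally have "L2_set (\<lambda>w. cmod (?c \<xi> w)) F \<le> sqrt (?p\<^sup>2 * infsum ?h \<G>)"
        unfolding L2_set_def by (rule real_sqrt_le_mono)
      then show ?thesis using p0 by (simp add: real_sqrt_mult ell2_norm_def)
    qed
    then have "ell2_norm \<G> (?c \<xi>) \<le> ?p * ell2_norm \<G> \<xi>"
      by (intro ell2_boundI(2)) (auto simp: convolution_eq)
    then show "ell2_norm \<G> (regular_rep G f \<xi>) \<le> ?p * ell2_norm \<G> \<xi>"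
      using \<xi> by (simp add: regular_rep_eq[OF f])
  qed
qed

lemma reduced_operator_algebra_iso_Cstar_red:
  "\<exists>\<Phi>. isometric_star_isomorphism (reduced_operator_algebra G) (Cstar_red G) \<Phi> \<and>
     (\<forall>f \<in> A0 G. regular_rep G f \<in> carr (reduced_operator_algebra G) \<and>
        \<Phi> (regular_rep G f) = Cstar_red_embedding G f)"
proof -
  interpret B: complete_normed_star_algebra "op_algebra \<G>"
    by (rule complete_normed_star_algebra_op_algebra)
  define A where "A = A0_algebra G (red_norm G)"
  have A: "carr A = A0 G" "aadd A = (\<lambda>f g x. f x + g x)" "ascale A = (\<lambda>c f x. c * f x)"
    "amult A = convolution G" "astar A = involution G" "nrm A = red_norm G"
    by (simp_all add: A_def A0_algebra_def)
  have "\<exists>\<Phi>. isometric_star_isomorphism ((op_algebra \<G>)\<lparr>carr := {T \<in> carr (op_algebra \<G>).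
        \<forall>e>0. \<exists>a\<in>carr A. dist_in (op_algebra \<G>) T (regular_rep G a) < e}\<rparr>) (completion A) \<Phi> \<and>
      (\<forall>a\<in>carr A. regular_rep G a \<in> carr ((op_algebra \<G>)\<lparr>carr := {T \<in> carr (op_algebra \<G>).
        \<forall>e>0. \<exists>a\<in>carr A. dist_in (op_algebra \<G>) T (regular_rep G a) < e}\<rparr>) \<and>
        \<Phi> (regular_rep G a) = completion_embedding A a)"
    by (rule B.closure_isometric_image_iso_completion)
      (simp_all only: A op_algebra_simps(1,6) A0_add A0_scale A0_convolution A0_involution
        regular_rep_bounded regular_rep_add regular_rep_scale regular_rep_mult regular_rep_star
        op_norm_regular_rep)
  then show ?thesis
    by (simp only: A reduced_operator_algebra_def Cstar_red_def Cstar_red_embedding_def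
        A_def[symmetric] op_algebra_simps(1))
qed

end

theorem theorem3p26:
  fixes G :: "'a topological_groupoid"
  assumes "etale_groupoid G"
  shows "(\<forall>f \<in> A0 G. op_norm (arrows G) (regular_rep G f) = red_norm G f) \<and>
    (\<exists>\<Phi>. isometric_star_isomorphism (reduced_operator_algebra G) (Cstar_red G) \<Phi> \<and>
         (\<forall>f \<in> A0 G. regular_rep G f \<in> carr (reduced_operator_algebra G) \<and>
            \<Phi> (regular_rep G f) = Cstar_red_embedding G f))"
proof -
  interpret etale G by unfold_locales (rule assms)
  show ?thesis
    using op_norm_regular_rep reduced_operator_algebra_iso_Cstar_red by blast
qed

end
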